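(* Let $\vec{\mu}$ be a Schmidt vector of length $n$, let $|\psi_{\vec{\mu}}\rangle\in\mathbb{C}^n\otimes\mathbb{C}^n$ be a pure state with Schmidt vector $\vec{\mu}$, let $p\in(0,1]$, and let $\rho_1,\rho_2$ be density matrices on $\mathbb{C}^n\otimes\mathbb{C}^n$. Suppose that $\rho_1\in S_{\vec{\mu},p}^{+}$ and that, in particular, it is possible to obtain $\rho_1$ from $|\psi_{\vec{\mu}}\rangle$ by LOCC with some probability $p_1\ge p$. Suppose that $\rho_2\notin S_{\vec{\mu},p}^{+}$. Then the maximum probability of success $p_2$ of obtaining $\rho_2$ from $\rho_1$ via LOCC operations satisfies $p_2<p/p_1$.
   Context: Setting: two parties, Alice and Bob, each hold a quantum system with Hilbert space $\mathbb{C}^n$. A Schmidt vector is $\vec{\mu}=(\mu^1,\dots,\mu^n)$ with $\mu^1\ge\dots\ge\mu^n\ge 0$ and $\sum_i\mu^i=1$. For a bipartite pure state $|\psi\rangle$, $\vec{\lambda}_\psi$ denotes the vector of Schmidt coefficients in decreasing order, i.e. the eigenvalues, in decreasing order, of $\mathrm{Tr}_A|\psi\rangle\langle\psi|$. Weak supermajorization: for vectors $\vec\lambda,\vec\mu$ with entries in decreasing order and summing to 1, $p\vec{\lambda}\succ^w\vec{\mu}$ means $p\sum_{i=l}^n\lambda^i\le\sum_{i=l}^n\mu^i$ for all $l=1,\dots,n$. LOCC operations: quantum operations built from local quantum operations (including measurements) by Alice and by Bob together with classical communication between them. A state $\sigma'$ is obtained from $\sigma$ by LOCC with probability $r$ if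 there is an LOCC protocol that, started on $\sigma$, announces success with probability $r$, the output state conditioned on success being $\sigma'$. The maximum probability of success is the maximum (supremum) of the achievable $r$. $\mathrm{LOCC}_1^A$ is the class of operations consisting of a local measurement/superoperator by Alice given by a set of commuting Kraus operators $A_i$ ($\sum_iA_i^\dagger A_i=\mathbf{1}$), followed by one-way classical communication from Alice to Bob, and local unitary transformations by Alice and Bob which may depend on Alice's outcome; i.e. maps $\mathcal{L}(\sigma)=\sum_i(U_iA_i\otimes V_i)\,\sigma\,(U_iA_i\otimes V_i)^\dagger$ with $U_i,V_i$ unitary. $S_{\vec{\mu},p}$ is the convex closure of the set of (projectors onto) pure states $|\psi\rangle\in\mathbb{C}^n\otimes\mathbb{C}^n$ with $p\vec{\lambda}_\psi\succ^w\vec{\mu}$; for a pure state, $|\psi\rangle\in S_{\vec{\mu},p}$ means $|\psi\rangle\langle\psi|\in S_{\vec{\mu},p}$. Further, $S_{\vec{\mu},p}^{+}=\{\mathcal{L}(|\psi\rangle\langle\psi|)\;|\;\mathcal{L}\in\mathrm{LOCC}_1^A,\ |\psi\rangle\in S_{\vec{\mu},p}\}$. *)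

theory Defs
  imports
    "Jordan_Normal_Form.Schur_Decomposition"
    "Jordan_Normal_Form.Char_Poly"
begin

definition sum_mats :: "nat \<Rightarrow> nat \<Rightarrow> complex mat list \<Rightarrow> complex mat" where
  "sum_mats nr nc Ms = foldr (+) Ms (0\<^sub>m nr nc)"

text \<open>In a tensor product of dimensions \<open>dA\<close> (Alice) and \<open>dB\<close> (Bob), the basis vector
  \<open>e\<^sub>a \<otimes> e\<^sub>b\<close> has index \<open>a * dB + b\<close>.\<close>

definition kron :: "complex mat \<Rightarrow> complex mat \<Rightarrow> complex mat" where
  "kron A B = mat (dim_row A * dim_row B) (dim_col A * dim_col B)
     (\<lambda>(i, j). A $$ (i div dim_row B, j div dim_col B) * B $$ (i mod dim_row B, j mod dim_col B))"

definition ptrace_A :: "nat \<Rightarrow> nat \<Rightarrow> complex mat \<Rightarrow> complex mat" where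
  "ptrace_A dA dB \<sigma> = mat dB dB (\<lambda>(b, b'). \<Sum>a<dA. \<sigma> $$ (a * dB + b, a * dB + b'))"

definition mat_trace :: "complex mat \<Rightarrow> complex" where
  "mat_trace A = (\<Sum>i<dim_row A. A $$ (i, i))"

definition unitary_mat :: "nat \<Rightarrow> complex mat \<Rightarrow> bool" where
  "unitary_mat d U \<longleftrightarrow> U \<in> carrier_mat d d \<and> mat_adjoint U * U = 1\<^sub>m d \<and> U * mat_adjoint U = 1\<^sub>m d"

text \<open>The order on \<^typ>\<open>complex\<close> satisfies \<open>0 \<le> z \<longleftrightarrow> Im z = 0 \<and> 0 \<le> Re z\<close>, so the quadratic
  form below is required to be real, which makes \<open>\<sigma>\<close> Hermitian.\<close>

definition density_mat :: "nat \<Rightarrow> complex mat \<Rightarrow> bool" where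
  "density_mat d \<sigma> \<longleftrightarrow> \<sigma> \<in> carrier_mat d d \<and> mat_trace \<sigma> = 1 \<and>
     (\<forall>v \<in> carrier_vec d. 0 \<le> (\<sigma> *\<^sub>v v) \<bullet>c v)"

definition pure_state :: "nat \<Rightarrow> complex vec \<Rightarrow> bool" where
  "pure_state d \<psi> \<longleftrightarrow> \<psi> \<in> carrier_vec d \<and> \<psi> \<bullet>c \<psi> = 1"

definition projector :: "complex vec \<Rightarrow> complex mat" where
  "projector \<psi> = mat (dim_vec \<psi>) (dim_vec \<psi>) (\<lambda>(i, j). \<psi> $ i * conjugate (\<psi> $ j))"

definition schmidt_vector :: "nat \<Rightarrow> real list \<Rightarrow> bool" where
  "schmidt_vector n \<mu> \<longleftrightarrow> length \<mu> = n \<and> sorted_wrt (\<ge>) \<mu> \<and> (\<forall>x \<in> set \<mu>. 0 \<le> x) \<and> sum_list \<mu> = 1"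

text \<open>The eigenvalues, with algebraic multiplicity, are the roots of the characteristic polynomial.
  They are real here because the reduced state is Hermitian, so \<^const>\<open>Re\<close> loses nothing.\<close>

definition schmidt_coeffs :: "nat \<Rightarrow> complex vec \<Rightarrow> real list" where
  "schmidt_coeffs n \<psi> =
     rev (sorted_list_of_multiset
       (image_mset Re (proots (char_poly (ptrace_A n n (projector \<psi>))))))"

text \<open>\<open>weak_supermaj p \<lambda> \<mu>\<close> is the relation \<open>p \<lambda> \<succ>\<^sup>w \<mu>\<close>; both lists are in decreasing order.\<close>

definition weak_supermaj :: "real \<Rightarrow> real list \<Rightarrow> real list \<Rightarrow> bool" where
  "weak_supermaj p lam \<mu> \<longleftrightarrow> length lam = length \<mu> \<and>
     (\<forall>l < length \<mu>. p * sum_list (drop l lam) \<le> sum_list (drop l \<mu>))"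

definition apply_kraus :: "nat \<Rightarrow> complex mat list \<Rightarrow> complex mat \<Rightarrow> complex mat" where
  "apply_kraus d Ks \<sigma> = sum_mats d d (map (\<lambda>K. K * \<sigma> * mat_adjoint K) Ks)"

text \<open>A quantum instrument on a \<open>d\<close>-dimensional system. The entry \<open>(m, Ks)\<close> describes one
  classical outcome: the system is then \<open>m\<close>-dimensional and was transformed by the completely
  positive map with Kraus operators \<open>Ks\<close>. Changing dimensions account for local ancillas and for
  discarding subsystems.\<close>

definition instrument :: "nat \<Rightarrow> (nat \<times> complex mat list) list \<Rightarrow> bool" where
  "instrument d Es \<longleftrightarrow>
     (\<forall>(m, Ks) \<in> set Es. \<forall>K \<in> set Ks. K \<in> carrier_mat m d) \<and>
     sum_mats d d (map (\<lambda>K. mat_adjoint K * K) (concat (map snd Es))) = 1\<^sub>m d"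

text \<open>\<open>locc n dA dB E\<close>: there is a finite LOCC protocol, started on systems of dimensions \<open>dA\<close> and
  \<open>dB\<close>, that either announces failure or announces success and outputs a state of two
  \<open>n\<close>-dimensional systems, and \<open>E\<close> is its unnormalized map for the outcome ``success''. In each
  round one party applies an instrument and broadcasts the outcome \<open>i\<close>, on which
  the remaining protocol \<open>P i\<close> depends.\<close>

inductive locc :: "nat \<Rightarrow> nat \<Rightarrow> nat \<Rightarrow> (complex mat \<Rightarrow> complex mat) \<Rightarrow> bool" for n :: nat where
  failure: "locc n dA dB (\<lambda>\<sigma>. 0\<^sub>m (n * n) (n * n))"
| success: "locc n n n (\<lambda>\<sigma>. \<sigma>)"
| alice: "instrument dA Es \<Longrightarrow> (\<And>i. i < length Es \<Longrightarrow> locc n (fst (Es ! i)) dB (P i)) \<Longrightarrow>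
    locc n dA dB (\<lambda>\<sigma>. sum_mats (n * n) (n * n)
      (map (\<lambda>i. P i (apply_kraus (fst (Es ! i) * dB)
                       (map (\<lambda>K. kron K (1\<^sub>m dB)) (snd (Es ! i))) \<sigma>)) [0..<length Es]))"
| bob: "instrument dB Es \<Longrightarrow> (\<And>i. i < length Es \<Longrightarrow> locc n dA (fst (Es ! i)) (P i)) \<Longrightarrow>
    locc n dA dB (\<lambda>\<sigma>. sum_mats (n * n) (n * n)
      (map (\<lambda>i. P i (apply_kraus (dA * fst (Es ! i))
                       (map (\<lambda>K. kron (1\<^sub>m dA) K) (snd (Es ! i))) \<sigma>)) [0..<length Es]))"

text \<open>For normalized \<open>\<sigma>'\<close> the trace of \<open>E \<sigma> = r \<sigma>'\<close> is \<open>r\<close>, so \<open>r\<close> is the success probability and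
  \<open>\<sigma>'\<close> the output state conditioned on success.\<close>

definition obtainable :: "nat \<Rightarrow> complex mat \<Rightarrow> complex mat \<Rightarrow> real \<Rightarrow> bool" where
  "obtainable n \<sigma> \<sigma>' r \<longleftrightarrow>
     0 \<le> r \<and> r \<le> 1 \<and> (\<exists>E. locc n n n E \<and> E \<sigma> = complex_of_real r \<cdot>\<^sub>m \<sigma>')"

definition max_success_prob :: "nat \<Rightarrow> complex mat \<Rightarrow> complex mat \<Rightarrow> real" where
  "max_success_prob n \<sigma> \<sigma>' = Sup {r. obtainable n \<sigma> \<sigma>' r}"

text \<open>For \<open>n\<^sup>2\<close>-dimensional \<open>\<sigma>'\<close> this set is nonempty, and it is bounded, so \<^const>\<open>Sup\<close> is the intended
  supremum.\<close>

lemma obtainable_0: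
  assumes "\<sigma>' \<in> carrier_mat (n * n) (n * n)"
  shows "obtainable n \<sigma> \<sigma>' 0"
proof -
  have "0\<^sub>m (n * n) (n * n) = complex_of_real 0 \<cdot>\<^sub>m \<sigma>'"
    using assms by (intro eq_matI) auto
  then show ?thesis
    unfolding obtainable_def by (auto intro!: exI[of _ "\<lambda>_. 0\<^sub>m (n * n) (n * n)"] locc.failure)
qed

lemma bdd_above_obtainable: "bdd_above {r. obtainable n \<sigma> \<sigma>' r}"
  unfolding obtainable_def by (auto intro: bdd_aboveI[of _ 1])

definition locc1A :: "nat \<Rightarrow> (complex mat \<Rightarrow> complex mat) \<Rightarrow> bool" where
  "locc1A n L \<longleftrightarrow> (\<exists>(k :: nat) A U V.
     (\<forall>i<k. A i \<in> carrier_mat n n \<and> unitary_mat n (U i) \<and> unitary_mat n (V i)) \<and>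
     (\<forall>i<k. \<forall>j<k. A i * A j = A j * A i) \<and>
     sum_mats n n (map (\<lambda>i. mat_adjoint (A i) * A i) [0..<k]) = 1\<^sub>m n \<and>
     L = apply_kraus (n * n) (map (\<lambda>i. kron (U i * A i) (V i)) [0..<k]))"

text \<open>The type of matrices of all dimensions is no real vector space, hence a convex hull of
  \<open>d \<times> d\<close> matrices is spelled out through finite convex combinations.\<close>

definition mat_convex_hull :: "nat \<Rightarrow> complex mat set \<Rightarrow> complex mat set" where
  "mat_convex_hull d X = {sum_mats d d (map (\<lambda>(q, M). complex_of_real q \<cdot>\<^sub>m M) qs) | qs.
     (\<forall>(q, M) \<in> set qs. 0 \<le> q \<and> M \<in> X) \<and> sum_list (map fst qs) = 1}"

definition S_set :: "nat \<Rightarrow> real list \<Rightarrow> real \<Rightarrow> complex mat set" where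
  "S_set n \<mu> p = mat_convex_hull (n * n)
     {projector \<psi> | \<psi>. pure_state (n * n) \<psi> \<and> weak_supermaj p (schmidt_coeffs n \<psi>) \<mu>}"

definition S_plus :: "nat \<Rightarrow> real list \<Rightarrow> real \<Rightarrow> complex mat set" where
  "S_plus n \<mu> p = {L (projector \<psi>) | L \<psi>.
     locc1A n L \<and> pure_state (n * n) \<psi> \<and> projector \<psi> \<in> S_set n \<mu> p}"

end

theory Submission
  imports Defs
begin

text \<open>Write \<open>T\<^sub>l(v)\<close> for the sum of all but the \<open>l\<close> largest Schmidt coefficients of a (not necessarily
  normalized) vector \<open>v\<close>. By Eckart and Young it is the squared distance of \<open>v\<close> to the tensors of
  rank at most \<open>l\<close>. In this form it is obvious that local measurements do not increase \<open>T\<^sub>l\<close> in the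
  sum over the branches, because a local operator does not increase ranks. So if \<open>\<rho>1\<close> is obtained
  from \<open>\<psi>\<close> with probability \<open>p1\<close> and \<open>\<rho>2\<close> from \<open>\<rho>1\<close> with probability \<open>r\<close>, then \<open>\<rho>2\<close> is a mixture of
  vectors \<open>u\<close> with \<open>r p1 (\<Sum>u. T\<^sub>l(u)) \<le> T\<^sub>l(\<psi>)\<close> for all \<open>l\<close>.

  By the conic version of Caratheodory's theorem, applied to the entries of the projectors together
  with the numbers \<open>T\<^sub>l\<close>, the number of vectors \<open>u\<close> can be bounded independently of the protocol. If
  the success probabilities \<open>r\<close> came arbitrarily close to \<open>p / p1\<close>, compactness of the set of
  Schmidt decompositions would therefore give a mixture with \<open>p (\<Sum>u. T\<^sub>l(u)) \<le> T\<^sub>l(\<psi>)\<close>. The state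
  whose Schmidt coefficients are the sums of the ordered Schmidt coefficients of the \<open>u\<close> then satisfies
  the majorization condition, and a measurement by Alice that is diagonal in its Schmidt basis produces
  the mixture, which puts \<open>\<rho>2\<close> into \<open>S_plus n \<mu> p\<close>.\<close>

section \<open>Orthonormal families\<close>

text \<open>A vector is a function on all natural numbers of which only the values below
  \<open>n\<close> matter, so equality of vectors appears as agreement at the indices
  \<open>a < n\<close>.\<close>

definition cinner :: "nat \<Rightarrow> (nat \<Rightarrow> complex) \<Rightarrow> (nat \<Rightarrow> complex) \<Rightarrow> complex" where
  "cinner n x y = (\<Sum>a<n. x a * cnj (y a))"

definition orthonormal :: "nat \<Rightarrow> nat \<Rightarrow> (nat \<Rightarrow> nat \<Rightarrow> complex) \<Rightarrow> bool" where
  "orthonormal n r q \<longleftrightarrow> (\<forall>i<r. \<forall>j<r. cinner n (q i) (q j) = (if i = j then 1 else 0))"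

lemma cinner_diff_left: "cinner n (\<lambda>a. x a - y a) z = cinner n x z - cinner n y z"
  by (simp add: cinner_def left_diff_distrib sum_subtractf)

lemma cinner_scale_left: "cinner n (\<lambda>a. c * x a) z = c * cinner n x z"
  by (simp add: cinner_def sum_distrib_left mult.assoc)

lemma cinner_sum_left: "cinner n (\<lambda>a. \<Sum>j\<in>J. f j a) z = (\<Sum>j\<in>J. cinner n (f j) z)"
  unfolding cinner_def by (subst sum.swap) (simp add: sum_distrib_right)

lemma cnj_cinner: "cnj (cinner n x y) = cinner n y x"
  by (simp add: cinner_def mult.commute)

lemma cinner_self: "cinner n x x = of_real (\<Sum>a<n. (cmod (x a))\<^sup>2)"
  by (simp add: cinner_def complex_norm_square del: of_real_power)

lemma cinner_cong:
  assumes "\<And>a. a < n \<Longrightarrow> x a = x' a" "\<And>a. a < n \<Longrightarrow> y a = y' a"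
  shows "cinner n x y = cinner n x' y'"
  unfolding cinner_def by (rule sum.cong) (auto simp: assms)

lemma cinner_scale_right: "cinner n x (\<lambda>a. c * y a) = cnj c * cinner n x y"
  by (metis cnj_cinner cinner_scale_left complex_cnj_mult)

lemma cinner_diff_right: "cinner n z (\<lambda>a. x a - y a) = cinner n z x - cinner n z y"
  by (metis cnj_cinner cinner_diff_left complex_cnj_diff)

text \<open>For an orthonormal family \<open>q\<close> this is the component of \<open>x\<close>
  orthogonal to the span of \<open>q\<close>; its vanishing below \<open>n\<close> expresses that
  \<open>x\<close> lies in that span.\<close>

definition residual :: "nat \<Rightarrow> nat \<Rightarrow> (nat \<Rightarrow> nat \<Rightarrow> complex) \<Rightarrow> (nat \<Rightarrow> complex) \<Rightarrow> nat \<Rightarrow> complex" where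
  "residual n r q x a = x a - (\<Sum>j<r. cinner n x (q j) * q j a)"

lemma cinner_residual:
  "cinner n (residual n r q x) z = cinner n x z - (\<Sum>j<r. cinner n x (q j) * cinner n (q j) z)"
proof -
  have "cinner n (residual n r q x) z
    = cinner n (\<lambda>a. x a - (\<Sum>j<r. cinner n x (q j) * q j a)) z"
    by (rule cinner_cong) (auto simp: residual_def)
  then show ?thesis by (simp add: cinner_diff_left cinner_sum_left cinner_scale_left)
qed

lemma residual_orthogonal:
  assumes "orthonormal n r q" "i < r"
  shows "cinner n (residual n r q x) (q i) = 0"
proof -
  have "(\<Sum>j<r. cinner n x (q j) * cinner n (q j) (q i))
      = (\<Sum>j<r. if j = i then cinner n x (q i) else 0)"
    by (rule sum.cong) (use assms in \<open>auto simp: orthonormal_def\<close>)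
  also have "\<dots> = cinner n x (q i)" using assms by simp
  finally show ?thesis by (simp add: cinner_residual)
qed

text \<open>Pythagoras: the residual is orthogonal to every \<open>q i\<close>, hence to the
  projection that was subtracted, and the mixed terms disappear.\<close>

lemma residual_norm:
  assumes "orthonormal n r q"
  shows "(\<Sum>a<n. (cmod (residual n r q x a))\<^sup>2)
    = (\<Sum>a<n. (cmod (x a))\<^sup>2) - (\<Sum>j<r. (cmod (cinner n x (q j)))\<^sup>2)"
proof -
  let ?d = "residual n r q x"
  have "cinner n ?d ?d = cinner n ?d x - cinner n ?d (\<lambda>a. \<Sum>j<r. cinner n x (q j) * q j a)"
    using cinner_diff_right[of n ?d x "\<lambda>a. \<Sum>j<r. cinner n x (q j) * q j a"]
    by (simp add: residual_def[abs_def])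
  also have "cinner n ?d (\<lambda>a. \<Sum>j<r. cinner n x (q j) * q j a) = 0"
  proof -
    have "cinner n (\<lambda>a. \<Sum>j<r. cinner n x (q j) * q j a) ?d = 0"
      unfolding cinner_sum_left cinner_scale_left
      using residual_orthogonal[OF assms, of _ x] cnj_cinner[of n ?d]
      by (intro sum.neutral) (metis complex_cnj_zero lessThan_iff mult_zero_right)
    then show ?thesis by (metis cnj_cinner complex_cnj_zero)
  qed
  also have "cinner n ?d x = cinner n x x - (\<Sum>j<r. of_real ((cmod (cinner n x (q j)))\<^sup>2))"
    unfolding cinner_residual complex_norm_square by (simp add: cnj_cinner)
  finally have "of_real (\<Sum>a<n. (cmod (?d a))\<^sup>2) =
    (of_real ((\<Sum>a<n. (cmod (x a))\<^sup>2) - (\<Sum>j<r. (cmod (cinner n x (q j)))\<^sup>2)) :: complex)"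
    unfolding cinner_self by simp
  then show ?thesis using of_real_eq_iff by blast
qed

lemma bessel:
  assumes "orthonormal n r q"
  shows "(\<Sum>j<r. (cmod (cinner n x (q j)))\<^sup>2) \<le> (\<Sum>a<n. (cmod (x a))\<^sup>2)"
proof -
  have "0 \<le> (\<Sum>a<n. (cmod (residual n r q x a))\<^sup>2)" by (intro sum_nonneg) auto
  then show ?thesis using residual_norm[OF assms, of x] by simp
qed

text \<open>One step of Gram-Schmidt. The new vector is the normalized residual of \<open>b\<close>;
  the coefficient of \<open>b\<close> along it is the norm of the residual, so the extended family
  leaves nothing of \<open>b\<close> over.\<close>

lemma orthonormal_update:
  assumes q: "orthonormal n r q" and d: "a0 < n" "residual n r q b a0 \<noteq> 0"
  shows "\<exists>c. orthonormal n (Suc r) (q(r := c)) \<and> (\<forall>a<n. residual n (Suc r) (q(r := c)) b a = 0)"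
proof -
  let ?d = "residual n r q b"
  define N where "N = (\<Sum>a<n. (cmod (?d a))\<^sup>2)"
  have "0 < (cmod (?d a0))\<^sup>2" using d by simp
  also have "\<dots> \<le> N" unfolding N_def by (rule member_le_sum) (use d in auto)
  finally have N: "0 < N" .
  define c where "c = (\<lambda>a. of_real (1 / sqrt N) * ?d a)"
  have dd: "cinner n ?d ?d = of_real N" by (simp add: cinner_self N_def)
  have sq: "complex_of_real (sqrt N) * complex_of_real (sqrt N) = of_real N"
    using N by (simp flip: of_real_mult)
  have cc: "cinner n c c = 1"
    unfolding c_def cinner_scale_left cinner_scale_right dd using N
    by (simp add: field_simps flip: sq)
  have cq: "cinner n c (q i) = 0" if "i < r" for i
    unfolding c_def cinner_scale_left using residual_orthogonal[OF q that] by simp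
  have qc: "cinner n (q i) c = 0" if "i < r" for i
    using cq[OF that] by (metis cnj_cinner complex_cnj_zero)
  have on: "orthonormal n (Suc r) (q(r := c))"
    using q cc cq qc by (auto simp: orthonormal_def less_Suc_eq)
  have "cinner n b c = cinner n ?d c"
    unfolding cinner_residual using qc by simp
  also have "\<dots> = of_real (1 / sqrt N) * of_real N"
    unfolding c_def cinner_scale_right dd by simp
  also have "\<dots> = of_real (sqrt N)" using N by (simp add: field_simps flip: sq)
  finally have bc: "cinner n b c = of_real (sqrt N)" .
  have "residual n (Suc r) (q(r := c)) b a = 0" for a
  proof -
    have "(\<Sum>j<Suc r. cinner n b ((q(r := c)) j) * (q(r := c)) j a)
        = (\<Sum>j<r. cinner n b (q j) * q j a) + ?d a"
      using N by (simp add: bc) (simp add: c_def field_simps)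
    then show ?thesis by (simp add: residual_def)
  qed
  with on show ?thesis by blast
qed

text \<open>Some standard basis vector has a nonzero residual, and Gram-Schmidt applies to it.
  Otherwise each of them would be exhausted by its coefficients, and counting the squared entries of
  the family in two ways would give \<open>n = r\<close>.\<close>

lemma orthonormal_extend:
  assumes "orthonormal n r q" "r < n"
  shows "\<exists>c. orthonormal n (Suc r) (q(r := c))"
proof (rule ccontr)
  assume no: "\<not> ?thesis"
  define e :: "nat \<Rightarrow> nat \<Rightarrow> complex" where "e i a = (if a = i then 1 else 0)" for i a
  have res: "residual n r q (e i) a = 0" if "a < n" for i a
    using orthonormal_update[OF assms(1) that, of "e i"] no by blast
  have "(\<Sum>j<r. (cmod (q j i))\<^sup>2) = 1" if "i < n" for i
  proof -
    have "cinner n (e i) (q j) = cnj (q j i)" for j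
    proof -
      have "cinner n (e i) (q j) = (\<Sum>a<n. if a = i then cnj (q j i) else 0)"
        unfolding cinner_def e_def by (rule sum.cong) auto
      then show ?thesis using that by simp
    qed
    moreover have "(\<Sum>a<n. (cmod (e i a))\<^sup>2) = (\<Sum>a<n. if a = i then 1 else 0)"
      by (rule sum.cong) (auto simp: e_def)
    ultimately show ?thesis using residual_norm[OF assms(1), of "e i"] res that by simp
  qed
  then have "real n = (\<Sum>i<n. \<Sum>j<r. (cmod (q j i))\<^sup>2)" by simp
  also have "\<dots> = (\<Sum>j<r. \<Sum>i<n. (cmod (q j i))\<^sup>2)" by (rule sum.swap)
  also have "\<dots> = (\<Sum>j<r. 1)"
  proof (rule sum.cong)
    fix j assume "j \<in> {..<r}"
    then have "cinner n (q j) (q j) = 1" using assms(1) by (auto simp: orthonormal_def)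
    then have "complex_of_real (\<Sum>i<n. (cmod (q j i))\<^sup>2) = of_real 1" unfolding cinner_self by simp
    then show "(\<Sum>i<n. (cmod (q j i))\<^sup>2) = 1" using of_real_eq_iff by blast
  qed simp
  finally show False using assms(2) by simp
qed

lemma orthonormal_completion:
  assumes "orthonormal n r q" "r \<le> n"
  shows "\<exists>q'. orthonormal n n q' \<and> (\<forall>j<r. q' j = q j)"
  using assms
proof (induction "n - r" arbitrary: r q)
  case 0
  then show ?case by (intro exI[of _ q]) simp
next
  case (Suc k)
  then obtain c where c: "orthonormal n (Suc r) (q(r := c))"
    using orthonormal_extend[of n r q] by fastforce
  have "k = n - Suc r" "Suc r \<le> n" using Suc.hyps(2) by auto
  from Suc.hyps(1)[OF this(1) c this(2)] obtain q' where
    "orthonormal n n q'" "\<forall>j<Suc r. q' j = (q(r := c)) j" by blast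
  then show ?case by (intro exI[of _ q']) auto
qed

text \<open>Gram-Schmidt without independence: a vector whose residual already vanishes is skipped,
  so \<open>m\<close> can be smaller than \<open>l\<close>.\<close>

lemma orthonormal_span:
  "\<exists>m q. m \<le> l \<and> orthonormal n m q \<and> (\<forall>k<l. \<forall>a<n. residual n m q (b k) a = 0)"
proof (induction l)
  case 0
  then show ?case by (intro exI[of _ 0]) (simp add: orthonormal_def)
next
  case (Suc l)
  then obtain m q where m: "m \<le> l" and q: "orthonormal n m q"
    and res: "\<forall>k<l. \<forall>a<n. residual n m q (b k) a = 0" by blast
  show ?case
  proof (cases "\<forall>a<n. residual n m q (b l) a = 0")
    case True
    with m q res show ?thesis by (intro exI[of _ m] exI[of _ q]) (auto simp: less_Suc_eq)
  next
    case False
    then obtain a0 where "a0 < n" "residual n m q (b l) a0 \<noteq> 0" by blast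
    from orthonormal_update[OF q this] obtain c where
      c: "orthonormal n (Suc m) (q(m := c))" "\<forall>a<n. residual n (Suc m) (q(m := c)) (b l) a = 0"
      by blast
    \<comment> \<open>Vectors spanned earlier stay spanned: they are combinations of the old family,
      hence orthogonal to \<open>c\<close>, and the new term of the residual is zero.\<close>
    have "residual n (Suc m) (q(m := c)) (b k) a = 0" if "k < l" "a < n" for k a
    proof -
      have bk: "b k a = (\<Sum>j<m. cinner n (b k) (q j) * q j a)" if "a < n" for a
        using res \<open>k < l\<close> that by (auto simp: residual_def)
      have "cinner n (b k) c = cinner n (\<lambda>a. \<Sum>j<m. cinner n (b k) (q j) * q j a) c"
        by (rule cinner_cong) (use bk in auto)
      also have "\<dots> = 0"
        unfolding cinner_sum_left cinner_scale_left
      proof (intro sum.neutral ballI)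
        fix j assume "j \<in> {..<m}"
        then have "cinner n ((q(m := c)) j) ((q(m := c)) m) = 0"
          using c(1) unfolding orthonormal_def by (metis lessI lessThan_iff less_SucI nat_neq_iff)
        then show "cinner n (b k) (q j) * cinner n (q j) c = 0" using \<open>j \<in> {..<m}\<close> by simp
      qed
      finally show ?thesis using bk[OF \<open>a < n\<close>] by (simp add: residual_def)
    qed
    with c m show ?thesis
      by (intro exI[of _ "Suc m"] exI[of _ "q(m := c)"]) (auto simp: less_Suc_eq simp del: fun_upd_apply)
  qed
qed

text \<open>The completeness relation of a basis: orthonormality makes \<open>B\<close> a right
  inverse of \<open>A\<close>, and for square matrices a right inverse is also a left
  inverse.\<close>

lemma orthonormal_complete:
  assumes "orthonormal n n q" "a < n" "b < n"
  shows "(\<Sum>i<n. q i a * cnj (q i b)) = (if a = b then 1 else 0)"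
proof -
  define A where "A = mat n n (\<lambda>(i, a). cnj (q i a))"
  define B where "B = mat n n (\<lambda>(a, i). q i a)"
  have AB: "A \<in> carrier_mat n n" "B \<in> carrier_mat n n" by (simp_all add: A_def B_def)
  have "A * B = 1\<^sub>m n"
    by (rule eq_matI) (use assms(1) in \<open>auto simp: A_def B_def scalar_prod_def orthonormal_def
      cinner_def mult.commute atLeast0LessThan\<close>)
  then have "B * A = 1\<^sub>m n" using mat_mult_left_right_inverse AB by blast
  then have "(B * A) $$ (a, b) = (if a = b then 1 else 0)" using assms by simp
  then show ?thesis using assms
    by (simp add: A_def B_def scalar_prod_def atLeast0LessThan)
qed

text \<open>By completeness every residual vanishes, which turns Bessel's inequality into an
  equality.\<close>

lemma parseval:
  assumes "orthonormal n n q"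
  shows "(\<Sum>i<n. (cmod (cinner n x (q i)))\<^sup>2) = (\<Sum>a<n. (cmod (x a))\<^sup>2)"
proof -
  have "residual n n q x a = 0" if "a < n" for a
  proof -
    have "(\<Sum>j<n. cinner n x (q j) * q j a) = (\<Sum>j<n. \<Sum>b<n. x b * (q j a * cnj (q j b)))"
      by (simp add: cinner_def sum_distrib_left mult_ac)
    also have "\<dots> = (\<Sum>b<n. x b * (\<Sum>j<n. q j a * cnj (q j b)))"
      by (subst sum.swap) (simp add: sum_distrib_left)
    also have "\<dots> = (\<Sum>b<n. if b = a then x a else 0)"
      by (rule sum.cong) (use orthonormal_complete[OF assms that] in auto)
    also have "\<dots> = x a" using that by simp
    finally show ?thesis by (simp add: residual_def)
  qed
  then show ?thesis using residual_norm[OF assms, of x] by simp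
qed

section \<open>Diagonalization of Hermitian matrices\<close>

lemma mat_adjoint_dim [simp]: "dim_row (mat_adjoint A) = dim_col A" "dim_col (mat_adjoint A) = dim_row A"
  by (simp_all add: mat_adjoint_def)

lemma mat_adjoint_carrier [simp]: "A \<in> carrier_mat n m \<Longrightarrow> mat_adjoint A \<in> carrier_mat m n"
  by auto

lemma mat_adjoint_index [simp]:
  "i < dim_col A \<Longrightarrow> j < dim_row A \<Longrightarrow> mat_adjoint (A :: complex mat) $$ (i, j) = cnj (A $$ (j, i))"
  by (simp add: mat_adjoint_def mat_of_rows_index)

lemma mat_adjoint_mult:
  assumes "A \<in> carrier_mat n m" "B \<in> carrier_mat m k"
  shows "mat_adjoint (A * B :: complex mat) = mat_adjoint B * mat_adjoint A"
  using assms by (intro eq_matI) (auto simp: scalar_prod_def mult.commute)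

lemma mat_adjoint_adjoint [simp]: "mat_adjoint (mat_adjoint A) = (A :: complex mat)"
  by (intro eq_matI) auto

lemma mat_adjoint_four_block:
  assumes "A \<in> carrier_mat n1 m1" "B \<in> carrier_mat n1 m2" "C \<in> carrier_mat n2 m1" "D \<in> carrier_mat n2 m2"
  shows "mat_adjoint (four_block_mat A B C D :: complex mat)
    = four_block_mat (mat_adjoint A) (mat_adjoint C) (mat_adjoint B) (mat_adjoint D)"
  using assms by (intro eq_matI) auto

lemma mat_adjoint_one [simp]: "mat_adjoint (1\<^sub>m n :: complex mat) = 1\<^sub>m n"
  by (intro eq_matI) auto

lemma mat_adjoint_zero [simp]: "mat_adjoint (0\<^sub>m n m :: complex mat) = 0\<^sub>m m n"
  by (intro eq_matI) auto

lemma unitary_mat_of_orthonormal: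
  assumes "orthonormal n n q"
  shows "unitary_mat n (mat n n (\<lambda>(a, i). q i a))"
  unfolding unitary_mat_def
proof (intro conjI)
  show "mat_adjoint (mat n n (\<lambda>(a, i). q i a)) * mat n n (\<lambda>(a, i). q i a) = 1\<^sub>m n"
    using assms by (intro eq_matI)
      (auto simp: scalar_prod_def orthonormal_def cinner_def atLeast0LessThan mult.commute)
  show "mat n n (\<lambda>(a, i). q i a) * mat_adjoint (mat n n (\<lambda>(a, i). q i a)) = 1\<^sub>m n"
    using orthonormal_complete[OF assms] by (intro eq_matI) (auto simp: scalar_prod_def atLeast0LessThan)
qed simp

lemma orthonormal_of_unitary_mat:
  assumes "unitary_mat n U"
  shows "orthonormal n n (\<lambda>i a. U $$ (a, i))"
  unfolding orthonormal_def
proof (intro allI impI)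
  fix i j assume "i < n" "j < n"
  then have "(mat_adjoint U * U) $$ (j, i) = (if i = j then 1 else 0)" "U \<in> carrier_mat n n"
    using assms by (auto simp: unitary_mat_def)
  then show "cinner n (\<lambda>a. U $$ (a, i)) (\<lambda>a. U $$ (a, j)) = (if i = j then 1 else 0)"
    using \<open>i < n\<close> \<open>j < n\<close>
    by (simp add: scalar_prod_def cinner_def atLeast0LessThan mult.commute)
qed

lemma unitary_with_first_column:
  assumes "v \<in> carrier_vec n" "v \<noteq> 0\<^sub>v n"
  shows "\<exists>W c. unitary_mat n W \<and> c \<noteq> 0 \<and> col W 0 = c \<cdot>\<^sub>v v"
proof -
  obtain a0 where a0: "a0 < n" "v $ a0 \<noteq> 0" using assms by (metis eq_vecI carrier_vecD index_zero_vec)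
  define N where "N = (\<Sum>a<n. (cmod (v $ a))\<^sup>2)"
  have "0 < (cmod (v $ a0))\<^sup>2" using a0 by simp
  also have "\<dots> \<le> N" unfolding N_def by (rule member_le_sum) (use a0 in auto)
  finally have N: "0 < N" .
  define c where "c = complex_of_real (1 / sqrt N)"
  have vv: "cinner n (($) v) (($) v) = of_real N" by (simp add: cinner_self N_def)
  have "cinner n (\<lambda>a. c * v $ a) (\<lambda>a. c * v $ a) = c * cnj c * of_real N"
    using vv by (simp add: cinner_scale_left cinner_scale_right)
  also have "\<dots> = of_real ((1 / sqrt N) * (1 / sqrt N) * N)"
    unfolding c_def complex_cnj_complex_of_real of_real_mult ..
  also have "(1 / sqrt N) * (1 / sqrt N) * N = 1" using N by (simp add: field_simps)
  finally have "orthonormal n 1 (\<lambda>_ a. c * v $ a)" by (simp add: orthonormal_def)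
  then obtain q where q: "orthonormal n n q" "q 0 = (\<lambda>a. c * v $ a)"
    using orthonormal_completion[of n 1 "\<lambda>_ a. c * v $ a"] a0 by auto
  have "col (mat n n (\<lambda>(a, i). q i a)) 0 = c \<cdot>\<^sub>v v"
    using assms a0 q(2) by (intro eq_vecI) auto
  moreover have "c \<noteq> 0" using N by (simp add: c_def)
  ultimately show ?thesis using unitary_mat_of_orthonormal[OF q(1)] by blast
qed

text \<open>Deflation by induction on the list of eigenvalues: a unitary whose first column is an
  eigenvector for \<open>e\<close> splits off a block of size one, and the remaining Hermitian block
  has the characteristic polynomial with the factor of \<open>e\<close> removed. The diagonal
  follows the order of \<open>es\<close>, so any ordering of the eigenvalues can be
  prescribed.\<close>

lemma hermitian_diagonalization:
  fixes A :: "complex mat"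
  assumes "A \<in> carrier_mat n n" "mat_adjoint A = A" "char_poly A = (\<Prod>e\<leftarrow>es. [:- e, 1:])"
  shows "\<exists>U. unitary_mat n U \<and> length es = n \<and> A * U = U * mat n n (\<lambda>(i, j). if i = j then es ! i else 0)"
  using assms
proof (induction es arbitrary: n A)
  case Nil
  then have "n = 0" using degree_monic_char_poly[of A n] by simp
  then show ?case using Nil(1)
    by (intro exI[of _ "1\<^sub>m 0"]) (auto simp: unitary_mat_def intro!: eq_matI)
next
  case (Cons e es n A)
  note A = Cons.prems(1) and herm = Cons.prems(2) and cp = Cons.prems(3)
  have "degree (char_poly A) = Suc (length es)"
    unfolding cp using degree_linear_factors[of uminus "e # es"] by simp
  then have n: "n = Suc (length es)" using degree_monic_char_poly[OF A] by simp
  then have n0: "0 < n" by simp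
  define k where "k = length es"
  have "eigenvalue A e" unfolding eigenvalue_root_char_poly[OF A] cp by simp
  then obtain v where v: "v \<in> carrier_vec n" "v \<noteq> 0\<^sub>v n" "A *\<^sub>v v = e \<cdot>\<^sub>v v"
    using A by (auto simp: eigenvalue_def eigenvector_def)
  obtain W c where W: "unitary_mat n W" and c: "c \<noteq> 0" "col W 0 = c \<cdot>\<^sub>v v"
    using unitary_with_first_column[OF v(1,2)] by blast
  have Wc: "W \<in> carrier_mat n n" and WW: "mat_adjoint W * W = 1\<^sub>m n" "W * mat_adjoint W = 1\<^sub>m n"
    using W by (auto simp: unitary_mat_def)
  have Ac: "mat_adjoint W \<in> carrier_mat n n" using Wc by simp
  define A' where "A' = mat_adjoint W * A * W"
  have A': "A' \<in> carrier_mat n n"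
    unfolding A'_def using Ac Wc A by (intro mult_carrier_mat[of _ n n])
  have herm': "mat_adjoint A' = A'"
    unfolding A'_def using A Wc Ac herm
    by (simp add: mat_adjoint_mult[of _ n n _ n] assoc_mult_mat[of _ n n _ n _ n])
  have AW: "A * W = W * A'"
  proof -
    have "W * A' = W * (mat_adjoint W * (A * W))"
      unfolding A'_def using A Wc Ac by (simp add: assoc_mult_mat[of _ n n _ n _ n])
    also have "\<dots> = W * mat_adjoint W * (A * W)"
      using A Wc Ac by (intro assoc_mult_mat[symmetric]) auto
    finally show ?thesis using WW(2) A Wc by simp
  qed
  have col0: "col A' 0 = e \<cdot>\<^sub>v unit_vec n 0"
  proof -
    have "col A' 0 = mat_adjoint W *\<^sub>v (A *\<^sub>v col W 0)"
      unfolding A'_def assoc_mult_mat[OF Ac A Wc]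
      using col_mult2[OF Ac mult_carrier_mat[OF A Wc] n0] col_mult2[OF A Wc n0] by simp
    also have "A *\<^sub>v col W 0 = e \<cdot>\<^sub>v col W 0"
      using A v c(2) by (simp add: mult_mat_vec[OF A] smult_smult_assoc mult.commute)
    also have "mat_adjoint W *\<^sub>v (e \<cdot>\<^sub>v col W 0) = e \<cdot>\<^sub>v (mat_adjoint W *\<^sub>v col W 0)"
      using Ac Wc n0 by (intro mult_mat_vec[of _ n n]) auto
    also have "mat_adjoint W *\<^sub>v col W 0 = col (mat_adjoint W * W) 0"
      using col_mult2[OF Ac Wc n0] by simp
    also have "\<dots> = unit_vec n 0" using n WW(1) by simp
    finally show ?thesis .
  qed
  have ent0: "A' $$ (i, 0) = (if i = 0 then e else 0)" if "i < n" for i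
    using arg_cong[OF col0, of "\<lambda>w. w $ i"] that A' n by auto
  \<comment> \<open>Hermiticity carries the zeros of the first column over to the first row, which
    makes \<open>A'\<close> block diagonal.\<close>
  have ent0': "A' $$ (0, j) = 0" if "j < n" "j \<noteq> 0" for j
  proof -
    have "mat_adjoint A' $$ (0, j) = cnj (A' $$ (j, 0))" using A' that by simp
    then show ?thesis using herm' ent0[OF that(1)] that by simp
  qed
  define A3 where "A3 = mat k k (\<lambda>(i, j). A' $$ (Suc i, Suc j))"
  have A3: "A3 \<in> carrier_mat k k" by (simp add: A3_def)
  have block: "A' = four_block_mat (mat 1 1 (\<lambda>_. e)) (0\<^sub>m 1 k) (0\<^sub>m k 1) A3"
    using A' n ent0 ent0' by (intro eq_matI) (auto simp: A3_def k_def)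
  have herm3: "mat_adjoint A3 = A3"
  proof (rule eq_matI)
    fix i j assume "i < dim_row A3" "j < dim_col A3"
    then have ij: "i < k" "j < k" using A3 by auto
    have "mat_adjoint A' $$ (Suc i, Suc j) = cnj (A' $$ (Suc j, Suc i))"
      using A' ij n by (simp add: k_def)
    then show "mat_adjoint A3 $$ (i, j) = A3 $$ (i, j)" using herm' ij by (simp add: A3_def)
  qed (use A3 in auto)
  have "similar_mat A' A"
    by (rule similar_matI[of _ _ "mat_adjoint W" W n]) (use A A' Wc Ac WW in \<open>auto simp: A'_def\<close>)
  then have "char_poly A' = [:- e, 1:] * (\<Prod>e\<leftarrow>es. [:- e, 1:])"
    using char_poly_similar cp by fastforce
  also have "char_poly A' = char_poly (mat 1 1 (\<lambda>_. e)) * char_poly A3"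
    unfolding block by (rule char_poly_four_block_zeros_col) (use A3 in auto)
  also have "char_poly (mat 1 1 (\<lambda>_. e)) = [:- e, 1:]"
    by (simp add: char_poly_defs det_def sign_def)
  finally have "char_poly A3 = (\<Prod>e\<leftarrow>es. [:- e, 1:])"
    by (metis mult_cancel_left pCons_eq_0_iff zero_neq_one)
  from Cons.IH[OF A3 herm3 this] obtain U3 where U3: "unitary_mat k U3"
    and AU3: "A3 * U3 = U3 * mat k k (\<lambda>(i, j). if i = j then es ! i else 0)" by blast
  have U3c: "U3 \<in> carrier_mat k k" and UU3: "mat_adjoint U3 * U3 = 1\<^sub>m k" "U3 * mat_adjoint U3 = 1\<^sub>m k"
    using U3 by (auto simp: unitary_mat_def)
  \<comment> \<open>\<open>F\<close> leaves the eigenvector just found alone and diagonalizes the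
    remaining block; \<open>W * F\<close> is the unitary sought.\<close>
  define F where "F = four_block_mat (1\<^sub>m 1) (0\<^sub>m 1 k) (0\<^sub>m k 1) U3"
  define D where "D = mat n n (\<lambda>(i, j). if i = j then (e # es) ! i else 0)"
  have Fc: "F \<in> carrier_mat n n" unfolding F_def n k_def[symmetric]
    using four_block_carrier_mat[of "1\<^sub>m 1" 1 1 U3 k k] U3c by simp
  have Dc: "D \<in> carrier_mat n n" by (simp add: D_def)
  have Dblock: "D = four_block_mat (mat 1 1 (\<lambda>_. e)) (0\<^sub>m 1 k) (0\<^sub>m k 1)
      (mat k k (\<lambda>(i, j). if i = j then es ! i else 0))"
    unfolding D_def by (intro eq_matI) (auto simp: n k_def nth_Cons split: nat.splits)
  have one: "mat 1 1 (\<lambda>_. e) * 1\<^sub>m 1 = mat 1 1 (\<lambda>_. e)" "1\<^sub>m 1 * mat 1 1 (\<lambda>_. e) = mat 1 1 (\<lambda>_. e)"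
    by (auto intro!: left_mult_one_mat right_mult_one_mat)
  have "A' * F = F * D"
    unfolding block F_def Dblock using A3 U3c AU3 one
    by (simp add: mult_four_block_mat[of _ 1 1 _ k _ k _ _ 1 _ k])
  then have AF: "A * (W * F) = (W * F) * D"
    using assoc_mult_mat[OF A Wc Fc] assoc_mult_mat[OF Wc A' Fc] assoc_mult_mat[OF Wc Fc Dc] AW
    by simp
  have Fadj: "mat_adjoint F = four_block_mat (1\<^sub>m 1) (0\<^sub>m 1 k) (0\<^sub>m k 1) (mat_adjoint U3)"
    unfolding F_def using U3c by (subst mat_adjoint_four_block[of _ 1 1 _ k _ k]) auto
  have FF: "mat_adjoint F * F = 1\<^sub>m n"
    unfolding Fadj unfolding F_def using U3c UU3 n
    by (simp add: mult_four_block_mat[of _ 1 1 _ k _ k _ _ 1 _ k] k_def)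
  have Fac: "mat_adjoint F \<in> carrier_mat n n" using Fc by simp
  have WF: "mat_adjoint (W * F) * (W * F) = 1\<^sub>m n"
  proof -
    have "mat_adjoint (W * F) * (W * F) = mat_adjoint F * ((mat_adjoint W * W) * F)"
      using Wc Fc Ac Fac
      by (simp add: mat_adjoint_mult[of _ n n _ n] assoc_mult_mat[of _ n n _ n _ n])
    then show ?thesis using WW FF Fc by simp
  qed
  have WFc: "W * F \<in> carrier_mat n n" "mat_adjoint (W * F) \<in> carrier_mat n n" using Wc Fc by auto
  have "unitary_mat n (W * F)"
    unfolding unitary_mat_def using WF WFc mat_mult_left_right_inverse[OF WFc(2,1) WF] by simp
  with AF show ?case unfolding D_def using n by auto
qed

section \<open>Schmidt decomposition\<close>

lemma sum_product_index: "(\<Sum>k<m * n. f k) = (\<Sum>a<m. \<Sum>b<n. f (a * n + b :: nat))"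
proof -
  have "sum f {a * n..<a * n + n} = (\<Sum>b<n. f (a * n + b))" for a
    using sum.shift_bounds_nat_ivl[of f 0 "a * n" n] by (simp add: atLeast0LessThan add.commute)
  then show ?thesis by (simp flip: sum.nat_group)
qed

lemma product_index_less:
  assumes "a < m" "b < (n :: nat)"
  shows "a * n + b < m * n"
proof -
  have "a * n + b < Suc a * n" using assms by simp
  also have "\<dots> \<le> m * n" using assms by (intro mult_le_mono1) simp
  finally show ?thesis .
qed

section \<open>Norms of combinations of orthonormal vectors and tensors\<close>

lemma orthonormal_combination_norm:
  assumes "orthonormal n r y"
  shows "(\<Sum>b<n. (cmod (\<Sum>i<r. \<alpha> i * y i b))\<^sup>2) = (\<Sum>i<r. (cmod (\<alpha> i))\<^sup>2)"
proof -
  let ?f = "\<lambda>b. \<Sum>i<r. \<alpha> i * y i b"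
  have inner: "cinner n ?f (y i) = \<alpha> i" if "i < r" for i
  proof -
    have "cinner n ?f (y i) = (\<Sum>j<r. \<alpha> j * cinner n (y j) (y i))"
      by (simp add: cinner_sum_left cinner_scale_left)
    also have "\<dots> = (\<Sum>j<r. if j = i then \<alpha> i else 0)"
      by (rule sum.cong) (use assms that in \<open>auto simp: orthonormal_def\<close>)
    finally show ?thesis using that by simp
  qed
  then have "residual n r y ?f b = 0" for b by (simp add: residual_def)
  then show ?thesis using residual_norm[OF assms, of ?f] inner by simp
qed

lemma orthonormal_norm:
  assumes "orthonormal n r q" "i < r"
  shows "(\<Sum>a<n. (cmod (q i a))\<^sup>2) = 1"
proof -
  have "cinner n (q i) (q i) = 1" using assms by (auto simp: orthonormal_def)
  then have "complex_of_real (\<Sum>a<n. (cmod (q i a))\<^sup>2) = of_real 1" unfolding cinner_self by simp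
  then show ?thesis using of_real_eq_iff by blast
qed

text \<open>Product tensors of two orthonormal bases are orthonormal. Summing over Bob's index first
  uses the orthonormality of \<open>y\<close>; after that only the normalization of \<open>x\<close>
  enters.\<close>

lemma double_orthonormal_norm:
  assumes "orthonormal n n x" "orthonormal n n y"
  shows "(\<Sum>a<n. \<Sum>b<n. (cmod (\<Sum>i<n. t i * x i a * y i b))\<^sup>2) = (\<Sum>i<n. (cmod (t i))\<^sup>2)"
proof -
  have "(\<Sum>a<n. \<Sum>b<n. (cmod (\<Sum>i<n. t i * x i a * y i b))\<^sup>2)
      = (\<Sum>a<n. \<Sum>i<n. (cmod (t i))\<^sup>2 * (cmod (x i a))\<^sup>2)"
    using orthonormal_combination_norm[OF assms(2)]
    by (simp add: norm_mult power_mult_distrib)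
  also have "\<dots> = (\<Sum>i<n. (cmod (t i))\<^sup>2 * (\<Sum>a<n. (cmod (x i a))\<^sup>2))"
    by (subst sum.swap) (simp add: sum_distrib_left)
  also have "\<dots> = (\<Sum>i<n. (cmod (t i))\<^sup>2)"
    using orthonormal_norm[OF assms(1)] by simp
  finally show ?thesis .
qed

text \<open>The singular value decomposition of the coefficient matrix of \<open>v\<close>; the
  squares of \<open>s\<close> are the Schmidt coefficients. Zero singular values are kept so that
  \<open>x\<close> and \<open>y\<close> are complete bases, and \<open>v\<close> may have any norm,
  because the branches of a measurement are not normalized.\<close>

definition schmidt_decomp ::
  "nat \<Rightarrow> complex vec \<Rightarrow> (nat \<Rightarrow> real) \<Rightarrow> (nat \<Rightarrow> nat \<Rightarrow> complex) \<Rightarrow> (nat \<Rightarrow> nat \<Rightarrow> complex) \<Rightarrow> bool" where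
  "schmidt_decomp n v s x y \<longleftrightarrow> orthonormal n n x \<and> orthonormal n n y \<and>
     (\<forall>i<n. 0 \<le> s i) \<and> (\<forall>j<n. \<forall>i\<le>j. s j \<le> s i) \<and>
     (\<forall>a<n. \<forall>b<n. v $ (a * n + b) = (\<Sum>i<n. of_real (s i) * x i a * y i b))"

text \<open>Contracting Bob's index of the coefficient matrix \<open>f\<close> with the conjugate of
  \<open>q i\<close> gives Alice's partner of \<open>q i\<close>. Inner products of partners are
  matrix elements of Bob's reduced state in the basis \<open>q\<close>, so an eigenvector
  \<open>q j\<close> makes them vanish off the diagonal and equal to the eigenvalue \<open>e\<close>
  on it.\<close>

lemma reduced_eigenbasis_gram:
  assumes q: "orthonormal n n q"
    and G: "\<And>b. b < n \<Longrightarrow> (\<Sum>b'<n. (\<Sum>a<n. f a b * cnj (f a b')) * q j b') = e * q j b"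
    and ij: "i < n" "j < n"
  shows "cinner n (\<lambda>a. \<Sum>b<n. f a b * cnj (q i b)) (\<lambda>a. \<Sum>b<n. f a b * cnj (q j b))
    = (if i = j then e else 0)"
proof -
  have "cinner n (\<lambda>a. \<Sum>b<n. f a b * cnj (q i b)) (\<lambda>a. \<Sum>b<n. f a b * cnj (q j b))
    = (\<Sum>a<n. \<Sum>b<n. \<Sum>b'<n. cnj (q i b) * (f a b * cnj (f a b') * q j b'))"
    unfolding cinner_def cnj_sum sum_product by (simp add: mult_ac)
  also have "\<dots> = (\<Sum>b<n. \<Sum>a<n. \<Sum>b'<n. cnj (q i b) * (f a b * cnj (f a b') * q j b'))"
    by (rule sum.swap)
  also have "\<dots> = (\<Sum>b<n. \<Sum>b'<n. \<Sum>a<n. cnj (q i b) * (f a b * cnj (f a b') * q j b'))"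
    by (intro sum.cong refl sum.swap)
  also have "\<dots> = (\<Sum>b<n. cnj (q i b) * (\<Sum>b'<n. (\<Sum>a<n. f a b * cnj (f a b')) * q j b'))"
    by (simp add: sum_distrib_left sum_distrib_right)
  also have "\<dots> = (\<Sum>b<n. cnj (q i b) * (e * q j b))" using G by simp
  also have "\<dots> = e * cinner n (q j) (q i)" by (simp add: cinner_def sum_distrib_left mult_ac)
  also have "\<dots> = (if i = j then e else 0)" using q ij by (auto simp: orthonormal_def)
  finally show ?thesis .
qed

lemma ptrace_A_index:
  assumes "v \<in> carrier_vec (n * n)" "b < n" "b' < n"
  shows "ptrace_A n n (projector v) $$ (b, b') = (\<Sum>a<n. v $ (a * n + b) * cnj (v $ (a * n + b')))"
  using assms by (auto simp: ptrace_A_def projector_def product_index_less intro!: sum.cong)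

lemma ptrace_A_carrier: "ptrace_A dA dB \<sigma> \<in> carrier_mat dB dB"
  by (simp add: ptrace_A_def)

lemma ptrace_A_eigenbasis:
  assumes v: "v \<in> carrier_vec (n * n)"
    and cp: "char_poly (ptrace_A n n (projector v)) = (\<Prod>e\<leftarrow>es. [:- e, 1:])"
  shows "\<exists>q. orthonormal n n q \<and> length es = n \<and>
    (\<forall>i<n. \<forall>j<n. cinner n (\<lambda>a. \<Sum>b<n. v $ (a * n + b) * cnj (q i b)) (\<lambda>a. \<Sum>b<n. v $ (a * n + b) * cnj (q j b))
      = (if i = j then es ! j else 0))"
proof -
  let ?G = "ptrace_A n n (projector v)"
  note G = ptrace_A_carrier[of n n "projector v"]
  have dim: "dim_row ?G = n" "dim_col ?G = n" using G by auto
  have herm: "mat_adjoint ?G = ?G"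
    using v by (intro eq_matI) (auto simp: dim ptrace_A_index mult.commute)
  obtain U where U: "unitary_mat n U" and len: "length es = n"
    and GU: "?G * U = U * mat n n (\<lambda>(i, j). if i = j then es ! i else 0)"
    using hermitian_diagonalization[OF G herm cp] by blast
  have Uc: "U \<in> carrier_mat n n" using U by (simp add: unitary_mat_def)
  let ?q = "\<lambda>i a. U $$ (a, i)"
  have q: "orthonormal n n ?q" by (rule orthonormal_of_unitary_mat[OF U])
  have eig: "(\<Sum>b'<n. (\<Sum>a<n. v $ (a * n + b) * cnj (v $ (a * n + b'))) * ?q j b') = es ! j * ?q j b"
    if "j < n" "b < n" for j b
  proof -
    have "(?G * U) $$ (b, j) = (\<Sum>b'<n. ?G $$ (b, b') * ?q j b')"
      using Uc that dim by (simp add: scalar_prod_def atLeast0LessThan)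
    moreover have "(U * mat n n (\<lambda>(i, j). if i = j then es ! i else 0)) $$ (b, j)
      = (\<Sum>k<n. if k = j then U $$ (b, j) * es ! j else 0)"
      using Uc that by (simp add: scalar_prod_def atLeast0LessThan if_distrib cong: if_cong)
    ultimately show ?thesis using GU that v by (simp add: ptrace_A_index mult.commute)
  qed
  show ?thesis
    using q len reduced_eigenbasis_gram[OF q eig] by blast
qed

lemma proots_linear_factors: "proots (\<Prod>e\<leftarrow>es. [:- e, 1:]) = mset (es :: complex list)"
proof (induction es)
  case (Cons e es)
  have "(\<Prod>e\<leftarrow>es. [:- e, 1:]) \<noteq> 0" by (auto simp: prod_list_zero_iff)
  then show ?case using Cons by (simp add: proots_mult del: mult_pCons_left)
qed simp

text \<open>Every root is the squared norm of a partner vector, hence real, so neither the real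
  parts nor the sorting in \<open>schmidt_coeffs\<close> change the multiset of roots.\<close>

lemma schmidt_coeffs_factorization:
  assumes v: "v \<in> carrier_vec (n * n)"
  shows "char_poly (ptrace_A n n (projector v)) = (\<Prod>e\<leftarrow>map complex_of_real (schmidt_coeffs n v). [:- e, 1:])"
proof -
  let ?G = "ptrace_A n n (projector v)"
  obtain es where es: "char_poly ?G = (\<Prod>e\<leftarrow>es. [:- e, 1:])"
    using char_poly_factorized[OF ptrace_A_carrier[of n n "projector v"]] by blast
  obtain q where q: "length es = n"
    "\<forall>i<n. \<forall>j<n. cinner n (\<lambda>a. \<Sum>b<n. v $ (a * n + b) * cnj (q i b)) (\<lambda>a. \<Sum>b<n. v $ (a * n + b) * cnj (q j b))
      = (if i = j then es ! j else 0)"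
    using ptrace_A_eigenbasis[OF v es] by blast
  have real: "complex_of_real (Re e) = e" if "e \<in> set es" for e
  proof -
    from that obtain i where "i < n" "e = es ! i" using q(1) by (auto simp: in_set_conv_nth)
    then have "e = cinner n (\<lambda>a. \<Sum>b<n. v $ (a * n + b) * cnj (q i b)) (\<lambda>a. \<Sum>b<n. v $ (a * n + b) * cnj (q i b))"
      using q(2) by auto
    then obtain R where "e = complex_of_real R" unfolding cinner_self by blast
    then show ?thesis by simp
  qed
  have "mset (schmidt_coeffs n v) = image_mset Re (mset es)"
    by (simp add: schmidt_coeffs_def es proots_linear_factors)
  then have "mset (map complex_of_real (schmidt_coeffs n v)) = image_mset (\<lambda>e. complex_of_real (Re e)) (mset es)"
    by (simp add: multiset.map_comp o_def)
  also have "\<dots> = image_mset (\<lambda>e. e) (mset es)" by (rule image_mset_cong) (use real in auto)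
  finally have m: "mset es = mset (map complex_of_real (schmidt_coeffs n v))" by simp
  have "(\<Prod>e\<leftarrow>es'. [:- e, 1:]) = prod_mset (image_mset (\<lambda>e. [:- e, 1:]) (mset es'))"
    for es' :: "complex list"
    by (simp flip: prod_mset_prod_list)
  then show ?thesis unfolding es by (simp only: m)
qed

lemma schmidt_coeffs_sorted: "j < length (schmidt_coeffs n v) \<Longrightarrow> i \<le> j \<Longrightarrow> schmidt_coeffs n v ! j \<le> schmidt_coeffs n v ! i"
  unfolding schmidt_coeffs_def
  by (auto simp: rev_nth intro!: sorted_nth_mono)

text \<open>Bob's basis \<open>q\<close> diagonalizes the reduced state with the eigenvalues in
  sorted order, and Alice's basis consists of the normalized partners of the \<open>q i\<close>.
  Partners that vanish cannot be normalized and are replaced by an arbitrary completion, which is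
  harmless since their coefficient is zero.\<close>

lemma schmidt_decomposition:
  assumes v: "v \<in> carrier_vec (n * n)"
  shows "length (schmidt_coeffs n v) = n" "\<forall>i<n. 0 \<le> schmidt_coeffs n v ! i"
    "\<exists>x y. schmidt_decomp n v (\<lambda>i. sqrt (schmidt_coeffs n v ! i)) x y"
proof -
  define L where "L = schmidt_coeffs n v"
  obtain q where q: "orthonormal n n q" and len: "length L = n"
    and gram: "\<forall>i<n. \<forall>j<n. cinner n (\<lambda>a. \<Sum>b<n. v $ (a * n + b) * cnj (q i b)) (\<lambda>a. \<Sum>b<n. v $ (a * n + b) * cnj (q j b))
      = (if i = j then map complex_of_real L ! j else 0)"
    using ptrace_A_eigenbasis[OF v schmidt_coeffs_factorization[OF v]] unfolding L_def by auto
  define Y where "Y i a = (\<Sum>b<n. v $ (a * n + b) * cnj (q i b))" for i a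
  have gram': "cinner n (Y i) (Y j) = (if i = j then of_real (L ! j) else 0)" if "i < n" "j < n" for i j
    using gram that len by (simp add: Y_def[abs_def])
  have LY: "L ! i = (\<Sum>a<n. (cmod (Y i a))\<^sup>2)" if "i < n" for i
    using gram'[OF that that] unfolding cinner_self by (metis of_real_eq_iff)
  have nonneg: "0 \<le> L ! i" if "i < n" for i
    unfolding LY[OF that] by (intro sum_nonneg) auto
  have sorted: "L ! j \<le> L ! i" if "j < n" "i \<le> j" for i j
    using schmidt_coeffs_sorted[of j n v i] that len by (simp add: L_def)
  define r where "r = card {i. i < n \<and> 0 < L ! i}"
  \<comment> \<open>The order of \<open>L\<close> puts the positive coefficients first, so they
    occupy exactly the indices below their number \<open>r\<close>.\<close>
  have set: "{i. i < n \<and> 0 < L ! i} = {..<r}"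
  proof -
    have down: "i \<in> {i. i < n \<and> 0 < L ! i}" if "j \<in> {i. i < n \<and> 0 < L ! i}" "i \<le> j" for i j
      using that sorted[of j i] by auto
    have "{i. i < n \<and> 0 < L ! i} = {..<card {i. i < n \<and> 0 < L ! i}}" (is "?P = _")
    proof (rule card_seteq[symmetric])
      show "finite ?P" by simp
      show "{..<card ?P} \<subseteq> ?P"
      proof
        fix i assume i: "i \<in> {..<card ?P}"
        show "i \<in> ?P"
        proof (rule ccontr)
          assume "i \<notin> ?P"
          then have "?P \<subseteq> {..<i}" using down by (meson lessThan_iff not_le subsetI)
          then have "card ?P \<le> i" using card_mono[of "{..<i}" ?P] by simp
          then show False using i by simp
        qed
      qed
    qed simp
    then show ?thesis by (simp add: r_def)
  qed
  have rn: "r \<le> n" unfolding r_def using card_mono[of "{..<n}" "{i. i < n \<and> 0 < L ! i}"] by auto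
  have pos: "0 < L ! i" if "i < r" for i using set that by blast
  have zero: "L ! i = 0" if "i < n" "\<not> i < r" for i
  proof -
    have "i \<notin> {i. i < n \<and> 0 < L ! i}" using that unfolding set by simp
    then show ?thesis using nonneg[OF that(1)] that(1) by auto
  qed
  define x0 where "x0 i a = of_real (1 / sqrt (L ! i)) * Y i a" for i a
  have "orthonormal n r x0"
    unfolding orthonormal_def
  proof (intro allI impI)
    fix i j assume ij: "i < r" "j < r"
    have "cinner n (x0 i) (x0 j) = of_real (1 / sqrt (L ! i)) * (of_real (1 / sqrt (L ! j)) * cinner n (Y i) (Y j))"
      unfolding x0_def[abs_def] cinner_scale_left cinner_scale_right by simp
    also have "\<dots> = (if i = j then of_real (1 / sqrt (L ! i) * (1 / sqrt (L ! i) * L ! i)) else 0)"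
      using ij rn gram'[of i j] by (cases "i = j") (simp_all only: of_real_mult, simp_all)
    also have "1 / sqrt (L ! i) * (1 / sqrt (L ! i) * L ! i) = 1"
      using pos[OF ij(1)] by (simp add: field_simps)
    also have "(if i = j then complex_of_real 1 else 0) = (if i = j then 1 else 0)" by simp
    finally show "cinner n (x0 i) (x0 j) = (if i = j then 1 else 0)" .
  qed
  then obtain x where x: "orthonormal n n x" "\<forall>j<r. x j = x0 j"
    using orthonormal_completion rn by blast
  have Yx: "of_real (sqrt (L ! i)) * x i a = Y i a" if "i < n" "a < n" for i a
  proof (cases "i < r")
    case True
    then show ?thesis using x(2) pos[OF True] by (simp add: x0_def)
  next
    case False
    then have "(\<Sum>a<n. (cmod (Y i a))\<^sup>2) = 0" using zero LY that by simp
    then have "(cmod (Y i a))\<^sup>2 = 0" using that by (subst (asm) sum_nonneg_eq_0_iff) auto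
    then show ?thesis using zero[OF that(1) False] by simp
  qed
  \<comment> \<open>Expanding Bob's index in the complete family \<open>q\<close> recovers
    \<open>v\<close>.\<close>
  have "v $ (a * n + b) = (\<Sum>i<n. of_real (sqrt (L ! i)) * x i a * q i b)" if "a < n" "b < n" for a b
  proof -
    have "(\<Sum>i<n. of_real (sqrt (L ! i)) * x i a * q i b) = (\<Sum>i<n. Y i a * q i b)"
      using Yx that by simp
    also have "\<dots> = (\<Sum>i<n. \<Sum>b'<n. v $ (a * n + b') * (q i b * cnj (q i b')))"
      by (simp add: Y_def sum_distrib_left mult_ac)
    also have "\<dots> = (\<Sum>b'<n. v $ (a * n + b') * (\<Sum>i<n. q i b * cnj (q i b')))"
      by (subst sum.swap) (simp add: sum_distrib_left)
    also have "\<dots> = (\<Sum>b'<n. if b' = b then v $ (a * n + b) else 0)"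
      by (rule sum.cong) (use orthonormal_complete[OF q] that in auto)
    finally show ?thesis using that by simp
  qed
  then have "schmidt_decomp n v (\<lambda>i. sqrt (L ! i)) x q"
    using x q nonneg sorted by (auto simp: schmidt_decomp_def)
  then show "length (schmidt_coeffs n v) = n" "\<forall>i<n. 0 \<le> schmidt_coeffs n v ! i"
    "\<exists>x y. schmidt_decomp n v (\<lambda>i. sqrt (schmidt_coeffs n v ! i)) x y"
    using nonneg len unfolding L_def by blast+
qed

section \<open>Approximation by low-rank tensors\<close>

text \<open>The pair \<open>BC\<close> holds the factors of a tensor with \<open>l\<close> product
  terms, thus an arbitrary tensor of rank at most \<open>l\<close>. The two dimensions are separate
  because a local operation may change one of them.\<close>

definition rank_error ::
  "nat \<Rightarrow> nat \<Rightarrow> nat \<Rightarrow> complex vec \<Rightarrow> (nat \<Rightarrow> nat \<Rightarrow> complex) \<times> (nat \<Rightarrow> nat \<Rightarrow> complex) \<Rightarrow> real" where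
  "rank_error dA dB l v BC =
     (\<Sum>a<dA. \<Sum>b<dB. (cmod (v $ (a * dB + b) - (\<Sum>k<l. fst BC a k * snd BC k b)))\<^sup>2)"

definition schmidt_tail :: "nat \<Rightarrow> nat \<Rightarrow> nat \<Rightarrow> complex vec \<Rightarrow> real" where
  "schmidt_tail dA dB l v = (INF BC. rank_error dA dB l v BC)"

lemma rank_error_nonneg: "0 \<le> rank_error dA dB l v BC"
  unfolding rank_error_def by (intro sum_nonneg) auto

lemma schmidt_tail_le: "schmidt_tail dA dB l v \<le> rank_error dA dB l v BC"
  unfolding schmidt_tail_def by (rule cINF_lower) (auto intro: bdd_belowI2 rank_error_nonneg)

lemma schmidt_tail_geI: "(\<And>BC. c \<le> rank_error dA dB l v BC) \<Longrightarrow> c \<le> schmidt_tail dA dB l v"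
  unfolding schmidt_tail_def by (rule cINF_greatest) auto

lemma schmidt_tail_nonneg: "0 \<le> schmidt_tail dA dB l v"
  by (rule schmidt_tail_geI) (rule rank_error_nonneg)

text \<open>The truncation of the Schmidt decomposition to its first \<open>l\<close> terms competes
  in the infimum, and its error is the tail.\<close>

lemma schmidt_tail_upper:
  assumes d: "schmidt_decomp n v s x y" and l: "l \<le> n"
  shows "schmidt_tail n n l v \<le> (\<Sum>i\<in>{l..<n}. (s i)\<^sup>2)"
proof -
  let ?BC = "(\<lambda>a k. of_real (s k) * x k a, \<lambda>k b. y k b)"
  define t where "t i = (if i < l then 0 else complex_of_real (s i))" for i
  have "v $ (a * n + b) - (\<Sum>k<l. of_real (s k) * x k a * y k b) = (\<Sum>i<n. t i * x i a * y i b)"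
    if "a < n" "b < n" for a b
  proof -
    have split: "{..<n} = {..<l} \<union> {l..<n}" using l by auto
    have "v $ (a * n + b) = (\<Sum>i<n. of_real (s i) * x i a * y i b)"
      using d that by (simp add: schmidt_decomp_def)
    also have "\<dots> = (\<Sum>i<l. of_real (s i) * x i a * y i b) + (\<Sum>i\<in>{l..<n}. of_real (s i) * x i a * y i b)"
      unfolding split by (rule sum.union_disjoint) auto
    also have "(\<Sum>i\<in>{l..<n}. of_real (s i) * x i a * y i b) = (\<Sum>i<n. t i * x i a * y i b)"
      by (rule sum.mono_neutral_cong_left) (auto simp: t_def)
    finally show ?thesis by simp
  qed
  then have "rank_error n n l v ?BC = (\<Sum>a<n. \<Sum>b<n. (cmod (\<Sum>i<n. t i * x i a * y i b))\<^sup>2)"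
    by (simp add: rank_error_def)
  also have "\<dots> = (\<Sum>i<n. (cmod (t i))\<^sup>2)"
    using d by (intro double_orthonormal_norm) (auto simp: schmidt_decomp_def)
  also have "\<dots> = (\<Sum>i\<in>{l..<n}. (s i)\<^sup>2)"
    using l by (intro sum.mono_neutral_cong_right) (auto simp: t_def)
  finally show ?thesis using schmidt_tail_le[of n n l v ?BC] by simp
qed

text \<open>Weights \<open>1 - g i\<close> between 0 and 1 with total at least \<open>n - l\<close>
  give the smallest weighted sum when they sit on the \<open>n - l\<close> smallest values.\<close>

lemma weighted_tail_bound:
  fixes t g :: "nat \<Rightarrow> real"
  assumes dec: "\<And>i j. j < n \<Longrightarrow> i \<le> j \<Longrightarrow> t j \<le> t i" and nonneg: "\<And>i. i < n \<Longrightarrow> 0 \<le> t i"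
    and g: "\<And>i. i < n \<Longrightarrow> 0 \<le> g i \<and> g i \<le> 1" and sum: "(\<Sum>i<n. g i) \<le> real l" and l: "l \<le> n"
  shows "(\<Sum>i\<in>{l..<n}. t i) \<le> (\<Sum>i<n. t i * (1 - g i))"
proof (cases "l = n")
  case True
  then show ?thesis using nonneg g by (auto intro!: sum_nonneg)
next
  case False
  then have ln: "l < n" using l by simp
  \<comment> \<open>\<open>h\<close> compares the weights with the indicator of the tail. It is
    nonnegative before \<open>l\<close> and nonpositive from \<open>l\<close> on, so replacing the
    decreasing \<open>t i\<close> by \<open>t l\<close> can only lower the sum, and the total of
    \<open>h\<close> is nonnegative.\<close>
  define h where "h i = (1 - g i) - (if l \<le> i then 1 else 0)" for i
  have ind: "(\<Sum>i<n. f i * (if l \<le> i then 1 else 0)) = (\<Sum>i\<in>{l..<n}. f i)" for f :: "nat \<Rightarrow> real"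
    by (intro sum.mono_neutral_cong_right) auto
  have "(\<Sum>i<n. h i) = real n - (\<Sum>i<n. g i) - (\<Sum>i<n. 1 * (if l \<le> i then 1 else 0))"
    by (simp add: h_def sum_subtractf)
  also have "\<dots> = real l - (\<Sum>i<n. g i)" unfolding ind using l by (simp add: of_nat_diff)
  finally have "0 \<le> t l * (\<Sum>i<n. h i)" using sum nonneg[OF ln] by simp
  also have "\<dots> = (\<Sum>i<n. t l * h i)" by (rule sum_distrib_left)
  also have "\<dots> \<le> (\<Sum>i<n. t i * h i)"
  proof (rule sum_mono)
    fix i assume i: "i \<in> {..<n}"
    show "t l * h i \<le> t i * h i"
    proof (cases "l \<le> i")
      case True
      then show ?thesis using dec[of i l] g[of i] i
        by (intro mult_right_mono_neg) (auto simp: h_def)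
    next
      case False
      then show ?thesis using dec[of l i] g[of i] i ln
        by (intro mult_right_mono) (auto simp: h_def)
    qed
  qed
  also have "\<dots> = (\<Sum>i<n. t i * (1 - g i)) - (\<Sum>i<n. t i * (if l \<le> i then 1 else 0))"
    unfolding h_def right_diff_distrib sum_subtractf ..
  finally show ?thesis unfolding ind by simp
qed

text \<open>The lower bound in the Eckart-Young theorem. Projecting away the column space of an
  approximating tensor, whose dimension \<open>m\<close> is at most \<open>l\<close>, kills that
  tensor and does not increase the norm of the error. What is left of \<open>v\<close> has as
  squared norm the sum of \<open>(s i)\<^sup>2 * (1 - g i)\<close>, where \<open>g i\<close> is the
  squared norm of the projection of \<open>x i\<close> onto that space.\<close>

lemma schmidt_tail_lower:
  assumes d: "schmidt_decomp n v s x y" and l: "l \<le> n"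
  shows "(\<Sum>i\<in>{l..<n}. (s i)\<^sup>2) \<le> schmidt_tail n n l v"
proof (rule schmidt_tail_geI)
  fix BC :: "(nat \<Rightarrow> nat \<Rightarrow> complex) \<times> (nat \<Rightarrow> nat \<Rightarrow> complex)"
  obtain B C where BC: "BC = (B, C)" by (cases BC)
  have x: "orthonormal n n x" and y: "orthonormal n n y" and s0: "\<And>i. i < n \<Longrightarrow> 0 \<le> s i"
    and sdec: "\<And>i j. j < n \<Longrightarrow> i \<le> j \<Longrightarrow> s j \<le> s i"
    and v: "\<And>a b. a < n \<Longrightarrow> b < n \<Longrightarrow> v $ (a * n + b) = (\<Sum>i<n. of_real (s i) * x i a * y i b)"
    using d by (auto simp: schmidt_decomp_def)
  obtain m q where m: "m \<le> l" and q: "orthonormal n m q"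
    and res: "\<And>k a. k < l \<Longrightarrow> a < n \<Longrightarrow> residual n m q (\<lambda>a. B a k) a = 0"
    using orthonormal_span[of l n "\<lambda>k a. B a k"] by blast
  define f where "f b a = v $ (a * n + b) - (\<Sum>k<l. B a k * C k b)" for a b
  define w where "w b a = v $ (a * n + b)" for a b
  \<comment> \<open>For each column \<open>b\<close>, the error \<open>f b\<close> and the vector
    \<open>w b\<close> differ by a combination of the columns of \<open>B\<close>, so they have the
    same residual.\<close>
  have low: "(\<Sum>a<n. (cmod (w b a))\<^sup>2) - (\<Sum>j<m. (cmod (cinner n (w b) (q j)))\<^sup>2) \<le> (\<Sum>a<n. (cmod (f b a))\<^sup>2)" for b
  proof -
    have "residual n m q (f b) a = residual n m q (w b) a" if "a < n" for a
    proof -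
      have ip: "cinner n (f b) z = cinner n (w b) z - (\<Sum>k<l. C k b * cinner n (\<lambda>a. B a k) z)" for z
        unfolding f_def[abs_def] w_def[abs_def] cinner_diff_left cinner_sum_left
        by (simp add: mult.commute[of "B _ _"] cinner_scale_left)
      have "residual n m q (f b) a = residual n m q (w b) a - (\<Sum>k<l. C k b * residual n m q (\<lambda>a. B a k) a)"
      proof -
        have "(\<Sum>j<m. (\<Sum>k<l. C k b * cinner n (\<lambda>a. B a k) (q j)) * q j a)
          = (\<Sum>k<l. C k b * (\<Sum>j<m. cinner n (\<lambda>a. B a k) (q j) * q j a))"
          unfolding sum_distrib_left sum_distrib_right mult.assoc by (rule sum.swap)
        moreover have "f b a = w b a - (\<Sum>k<l. C k b * B a k)"
          by (simp add: f_def w_def mult.commute)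
        ultimately show ?thesis
          unfolding residual_def ip by (simp add: left_diff_distrib right_diff_distrib sum_subtractf)
      qed
      then show ?thesis using res that by simp
    qed
    then have "(\<Sum>a<n. (cmod (residual n m q (f b) a))\<^sup>2) = (\<Sum>a<n. (cmod (residual n m q (w b) a))\<^sup>2)"
      by simp
    moreover have "0 \<le> (\<Sum>j<m. (cmod (cinner n (f b) (q j)))\<^sup>2)" by (intro sum_nonneg) auto
    ultimately show ?thesis using residual_norm[OF q, of "f b"] residual_norm[OF q, of "w b"] by simp
  qed
  define g where "g i = (\<Sum>j<m. (cmod (cinner n (x i) (q j)))\<^sup>2)" for i
  have wnorm: "(\<Sum>b<n. \<Sum>a<n. (cmod (w b a))\<^sup>2) = (\<Sum>i<n. (s i)\<^sup>2)"
  proof -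
    have "(\<Sum>b<n. \<Sum>a<n. (cmod (w b a))\<^sup>2) = (\<Sum>a<n. \<Sum>b<n. (cmod (w b a))\<^sup>2)" by (rule sum.swap)
    also have "\<dots> = (\<Sum>a<n. \<Sum>b<n. (cmod (\<Sum>i<n. of_real (s i) * x i a * y i b))\<^sup>2)"
      by (simp add: w_def v)
    also have "\<dots> = (\<Sum>i<n. (s i)\<^sup>2)" by (subst double_orthonormal_norm[OF x y]) simp
    finally show ?thesis .
  qed
  have proj: "(\<Sum>b<n. \<Sum>j<m. (cmod (cinner n (w b) (q j)))\<^sup>2) = (\<Sum>i<n. (s i)\<^sup>2 * g i)"
  proof -
    have "cinner n (w b) (q j) = (\<Sum>i<n. (of_real (s i) * cinner n (x i) (q j)) * y i b)" if "b < n" for b j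
    proof -
      have "cinner n (w b) (q j) = cinner n (\<lambda>a. \<Sum>i<n. (of_real (s i) * y i b) * x i a) (q j)"
        by (rule cinner_cong) (use that in \<open>simp_all add: w_def v mult_ac\<close>)
      also have "\<dots> = (\<Sum>i<n. (of_real (s i) * y i b) * cinner n (x i) (q j))"
        unfolding cinner_sum_left cinner_scale_left ..
      finally show ?thesis by (simp add: mult_ac)
    qed
    then have "(\<Sum>b<n. \<Sum>j<m. (cmod (cinner n (w b) (q j)))\<^sup>2)
      = (\<Sum>b<n. \<Sum>j<m. (cmod (\<Sum>i<n. (of_real (s i) * cinner n (x i) (q j)) * y i b))\<^sup>2)" by simp
    also have "\<dots> = (\<Sum>j<m. \<Sum>b<n. (cmod (\<Sum>i<n. (of_real (s i) * cinner n (x i) (q j)) * y i b))\<^sup>2)"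
      by (rule sum.swap)
    also have "\<dots> = (\<Sum>j<m. \<Sum>i<n. (s i)\<^sup>2 * (cmod (cinner n (x i) (q j)))\<^sup>2)"
      unfolding orthonormal_combination_norm[OF y] by (simp add: norm_mult power_mult_distrib)
    also have "\<dots> = (\<Sum>i<n. \<Sum>j<m. (s i)\<^sup>2 * (cmod (cinner n (x i) (q j)))\<^sup>2)"
      by (rule sum.swap)
    also have "\<dots> = (\<Sum>i<n. (s i)\<^sup>2 * g i)"
      unfolding g_def sum_distrib_left ..
    finally show ?thesis .
  qed
  \<comment> \<open>The trace of the projection onto an \<open>m\<close>-dimensional space, computed
    in the basis \<open>x\<close>.\<close>
  have gsum: "(\<Sum>i<n. g i) = real m"
  proof -
    have sym: "cmod (cinner n (x i) (q j)) = cmod (cinner n (q j) (x i))" for i j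
      by (metis cnj_cinner complex_mod_cnj)
    have "(\<Sum>i<n. g i) = (\<Sum>j<m. \<Sum>i<n. (cmod (cinner n (x i) (q j)))\<^sup>2)"
      unfolding g_def by (rule sum.swap)
    also have "\<dots> = (\<Sum>j<m. \<Sum>i<n. (cmod (cinner n (q j) (x i)))\<^sup>2)"
      using sym by simp
    also have "\<dots> = (\<Sum>j<m. 1)"
    proof (rule sum.cong)
      fix j assume "j \<in> {..<m}"
      then show "(\<Sum>i<n. (cmod (cinner n (q j) (x i)))\<^sup>2) = 1"
        unfolding parseval[OF x] using orthonormal_norm[OF q] by blast
    qed simp
    finally show ?thesis by simp
  qed
  have g01: "0 \<le> g i \<and> g i \<le> 1" if "i < n" for i
  proof
    show "0 \<le> g i" unfolding g_def by (intro sum_nonneg) auto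
    show "g i \<le> 1" using bessel[OF q, of "x i"] orthonormal_norm[OF x that] by (simp add: g_def)
  qed
  have "(\<Sum>i\<in>{l..<n}. (s i)\<^sup>2) \<le> (\<Sum>i<n. (s i)\<^sup>2 * (1 - g i))"
  proof (rule weighted_tail_bound)
    show "(s j)\<^sup>2 \<le> (s i)\<^sup>2" if "j < n" "i \<le> j" for i j
      using sdec[OF that] s0[OF that(1)] by (intro power_mono)
    show "0 \<le> (s i)\<^sup>2" for i by simp
    show "0 \<le> g i \<and> g i \<le> 1" if "i < n" for i by (rule g01[OF that])
    show "(\<Sum>i<n. g i) \<le> real l" using gsum m by simp
    show "l \<le> n" by (rule l)
  qed
  also have "\<dots> = (\<Sum>b<n. (\<Sum>a<n. (cmod (w b a))\<^sup>2) - (\<Sum>j<m. (cmod (cinner n (w b) (q j)))\<^sup>2))"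
    by (simp add: right_diff_distrib sum_subtractf wnorm proj)
  also have "\<dots> \<le> (\<Sum>b<n. \<Sum>a<n. (cmod (f b a))\<^sup>2)" by (intro sum_mono low)
  also have "\<dots> = (\<Sum>a<n. \<Sum>b<n. (cmod (f b a))\<^sup>2)" by (rule sum.swap)
  also have "\<dots> = rank_error n n l v BC" by (simp add: rank_error_def BC f_def)
  finally show "(\<Sum>i\<in>{l..<n}. (s i)\<^sup>2) \<le> rank_error n n l v BC" .
qed

section \<open>Conic Caratheodory theorem\<close>

text \<open>Gaussian elimination: a member \<open>k0\<close> with nonzero coordinate
  \<open>j\<close> is used to clear this coordinate from the others. A dependence among the cleared
  vectors then determines the coefficient of \<open>k0\<close>.\<close>

lemma homogeneous_dependence:
  fixes x :: "'k \<Rightarrow> 'j \<Rightarrow> real"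
  assumes "finite J" "finite K" "card J < card K"
  shows "\<exists>d. (\<exists>k\<in>K. d k \<noteq> 0) \<and> (\<forall>j\<in>J. (\<Sum>k\<in>K. d k * x k j) = 0)"
  using assms
proof (induction J arbitrary: K x rule: finite_induct)
  case empty
  then have "K \<noteq> {}" by auto
  then show ?case by (intro exI[of _ "\<lambda>_. 1"]) auto
next
  case (insert j J)
  show ?case
  proof (cases "\<forall>k\<in>K. x k j = 0")
    case True
    have "card J < card K" using insert by simp
    then obtain d where "\<exists>k\<in>K. d k \<noteq> 0" "\<forall>j\<in>J. (\<Sum>k\<in>K. d k * x k j) = 0"
      using insert.IH[of K x] insert.prems(1) by blast
    with True show ?thesis by (intro exI[of _ d]) auto
  next
    case False
    then obtain k0 where k0: "k0 \<in> K" "x k0 j \<noteq> 0" by blast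
    define K' where "K' = K - {k0}"
    have K: "K = insert k0 K'" "k0 \<notin> K'" "finite K'" using k0 insert.prems by (auto simp: K'_def)
    have "card J < card K'" using insert K by simp
    then obtain d where d: "\<exists>k\<in>K'. d k \<noteq> 0"
      "\<forall>i\<in>J. (\<Sum>k\<in>K'. d k * (x k i - x k j / x k0 j * x k0 i)) = 0"
      using insert.IH[of K' "\<lambda>k i. x k i - x k j / x k0 j * x k0 i"] K(3) by blast
    define c where "c = - (\<Sum>k\<in>K'. d k * x k j) / x k0 j"
    have total: "(\<Sum>k\<in>K. (d(k0 := c)) k * x k i) = c * x k0 i + (\<Sum>k\<in>K'. d k * x k i)" for i
    proof -
      have "(\<Sum>k\<in>K'. (d(k0 := c)) k * x k i) = (\<Sum>k\<in>K'. d k * x k i)"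
        by (rule sum.cong) (use K(2) in auto)
      then show ?thesis unfolding K(1) using K(2,3) by simp
    qed
    have "(\<Sum>k\<in>K. (d(k0 := c)) k * x k i) = 0" if "i \<in> insert j J" for i
    proof (cases "i = j")
      case True
      then show ?thesis unfolding total using k0 by (simp add: c_def)
    next
      case False
      then have "(\<Sum>k\<in>K'. d k * (x k i - x k j / x k0 j * x k0 i)) = 0" using d that by auto
      moreover have "(\<Sum>k\<in>K'. d k * (x k i - x k j / x k0 j * x k0 i))
        = (\<Sum>k\<in>K'. d k * x k i) - (\<Sum>k\<in>K'. d k * x k j) / x k0 j * x k0 i"
        by (simp add: right_diff_distrib sum_subtractf sum_distrib_right sum_divide_distrib mult.assoc)
      ultimately show ?thesis unfolding total by (simp add: c_def)
    qed
    moreover have "\<exists>k\<in>K. (d(k0 := c)) k \<noteq> 0" using d(1) K by auto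
    ultimately show ?thesis by (intro exI[of _ "d(k0 := c)"]) blast
  qed
qed

text \<open>As long as there are more terms than coordinates, a multiple of a linear dependence is
  subtracted until some coefficient reaches zero. The weights need not sum to one, hence
  \<open>card J\<close> terms suffice where the convex version allows one more.\<close>

lemma conic_caratheodory:
  fixes x :: "'k \<Rightarrow> 'j \<Rightarrow> real" and c :: "'k \<Rightarrow> real"
  assumes "finite J" "finite K" "\<forall>k\<in>K. 0 \<le> c k"
  shows "\<exists>K' c'. K' \<subseteq> K \<and> card K' \<le> card J \<and> (\<forall>k\<in>K'. 0 \<le> c' k) \<and>
    (\<forall>j\<in>J. (\<Sum>k\<in>K'. c' k * x k j) = (\<Sum>k\<in>K. c k * x k j))"
  using assms(2,3)
proof (induction "card K" arbitrary: K c rule: less_induct)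
  case less
  show ?case
  proof (cases "card K \<le> card J")
    case True
    then show ?thesis using less.prems by (intro exI[of _ K] exI[of _ c]) simp
  next
    case False
    then obtain d0 where d0: "\<exists>k\<in>K. d0 k \<noteq> 0" "\<forall>j\<in>J. (\<Sum>k\<in>K. d0 k * x k j) = 0"
      using homogeneous_dependence[OF assms(1) less.prems(1)] by (metis not_le)
    \<comment> \<open>If no coefficient of the dependence is positive, its negative has a positive
      one; thus the smallest ratio below is taken over a nonempty set.\<close>
    obtain d where d: "\<exists>k\<in>K. 0 < d k" "\<forall>j\<in>J. (\<Sum>k\<in>K. d k * x k j) = 0"
    proof (cases "\<exists>k\<in>K. 0 < d0 k")
      case True
      then show ?thesis using d0 that by blast
    next
      case False
      then have "\<exists>k\<in>K. 0 < - d0 k" using d0(1) by (metis neg_0_less_iff_less linorder_neqE_linordered_idom)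
      moreover have "\<forall>j\<in>J. (\<Sum>k\<in>K. - d0 k * x k j) = 0" using d0(2) by (simp add: sum_negf)
      ultimately show ?thesis using that[of "\<lambda>k. - d0 k"] by blast
    qed
    define P where "P = {k \<in> K. 0 < d k}"
    have P: "finite P" "P \<noteq> {}" using d(1) less.prems by (auto simp: P_def)
    \<comment> \<open>The minimal ratio is the largest multiple of \<open>d\<close> that can be
      subtracted while all coefficients stay nonnegative, and it brings the coefficient of
      \<open>k1\<close> to zero.\<close>
    define k1 where "k1 = arg_min_on (\<lambda>k. c k / d k) P"
    have k1: "k1 \<in> P" "\<And>k. k \<in> P \<Longrightarrow> c k1 / d k1 \<le> c k / d k"
      using arg_min_if_finite(1)[OF P] arg_min_least[OF P] by (auto simp: k1_def)
    define e where "e k = c k - c k1 / d k1 * d k" for k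
    have e: "0 \<le> e k" if "k \<in> K" for k
    proof (cases "0 < d k")
      case True
      then have "c k1 / d k1 \<le> c k / d k" using k1(2) that by (simp add: P_def)
      then show ?thesis using True by (simp add: e_def field_simps)
    next
      case False
      moreover have "0 \<le> c k1 / d k1" using k1(1) less.prems(2) by (simp add: P_def)
      ultimately have "c k1 / d k1 * d k \<le> 0" by (intro mult_nonneg_nonpos) simp_all
      then show ?thesis using less.prems(2) that by (auto simp: e_def intro: order_trans)
    qed
    have k1K: "k1 \<in> K" "d k1 \<noteq> 0" using k1(1) by (auto simp: P_def)
    have ek1: "e k1 = 0" using k1K by (simp add: e_def)
    have esum: "(\<Sum>k\<in>K - {k1}. e k * x k j) = (\<Sum>k\<in>K. c k * x k j)" if "j \<in> J" for j
    proof -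
      have "(\<Sum>k\<in>K - {k1}. e k * x k j) = (\<Sum>k\<in>K. e k * x k j)"
        using ek1 k1K less.prems by (simp add: sum.remove[of K k1])
      also have "\<dots> = (\<Sum>k\<in>K. c k * x k j) - c k1 / d k1 * (\<Sum>k\<in>K. d k * x k j)"
        by (simp add: e_def left_diff_distrib sum_subtractf sum_distrib_left mult.assoc)
      finally show ?thesis using d(2) that by simp
    qed
    have "card (K - {k1}) < card K" using k1K less.prems by (meson card_Diff1_less)
    moreover have "finite (K - {k1})" "\<forall>k\<in>K - {k1}. 0 \<le> e k" using less.prems(1) e by auto
    ultimately obtain K' c' where
      "K' \<subseteq> K - {k1}" "card K' \<le> card J" "\<forall>k\<in>K'. 0 \<le> c' k"
      "\<forall>j\<in>J. (\<Sum>k\<in>K'. c' k * x k j) = (\<Sum>k\<in>K - {k1}. e k * x k j)"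
      using less.hyps[of "K - {k1}" e] by blast
    then show ?thesis using esum by (intro exI[of _ K'] exI[of _ c']) auto
  qed
qed

text \<open>The selection is padded with zero weights to exactly \<open>card J\<close> terms, so
  that the index set no longer depends on the original family.\<close>

lemma conic_caratheodory_indexed:
  fixes x :: "'k \<Rightarrow> 'j \<Rightarrow> real"
  assumes "finite J" "finite K" "K \<noteq> {}"
  shows "\<exists>\<kappa> c. \<forall>i<card J. \<kappa> i \<in> K \<and> 0 \<le> c i \<and>
    (\<forall>j\<in>J. (\<Sum>i<card J. c i * x (\<kappa> i) j) = (\<Sum>k\<in>K. x k j))"
proof -
  obtain K' c' where K': "K' \<subseteq> K" "card K' \<le> card J" "\<forall>k\<in>K'. 0 \<le> c' k"
    "\<forall>j\<in>J. (\<Sum>k\<in>K'. c' k * x k j) = (\<Sum>k\<in>K. 1 * x k j)"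
    using conic_caratheodory[OF assms(1,2), of "\<lambda>_. 1" x] by auto
  have "finite K'" using K'(1) assms(2) finite_subset by blast
  then obtain h where h: "bij_betw h {..<card K'} K'"
    using ex_bij_betw_nat_finite[of K'] by (auto simp: atLeast0LessThan)
  obtain k0 where "k0 \<in> K" using assms(3) by blast
  define \<kappa> where "\<kappa> i = (if i < card K' then h i else k0)" for i
  define c where "c i = (if i < card K' then c' (h i) else 0)" for i
  have "(\<Sum>i<card J. c i * x (\<kappa> i) j) = (\<Sum>k\<in>K. x k j)" if "j \<in> J" for j
  proof -
    have "(\<Sum>i<card J. c i * x (\<kappa> i) j) = (\<Sum>i<card K'. c' (h i) * x (h i) j)"
      using K'(2) by (intro sum.mono_neutral_cong_right) (auto simp: c_def \<kappa>_def)
    also have "\<dots> = (\<Sum>k\<in>K'. c' k * x k j)" by (rule sum.reindex_bij_betw[OF h])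
    finally show ?thesis using K'(4) that by simp
  qed
  moreover have "\<kappa> i \<in> K" "0 \<le> c i" for i
    using K'(1,3) h \<open>k0 \<in> K\<close> by (auto simp: \<kappa>_def c_def bij_betw_def)
  ultimately show ?thesis by blast
qed

section \<open>Convergent subsequences\<close>

text \<open>Bolzano-Weierstrass by way of a monotone subsequence.\<close>

lemma bounded_real_seq_convergent_subseq:
  fixes f :: "nat \<Rightarrow> real"
  assumes "\<And>m. \<bar>f m\<bar> \<le> B"
  shows "\<exists>r :: nat \<Rightarrow> nat. strict_mono r \<and> convergent (\<lambda>m. f (r m))"
proof -
  obtain r where r: "strict_mono r" "monoseq (\<lambda>m. f (r m))" using seq_monosub[of f] by blast
  have "Bseq (\<lambda>m. f (r m))" using assms by (intro BseqI'[of _ B]) auto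
  then show ?thesis using r Bseq_monoseq_convergent by blast
qed

lemma bounded_complex_seq_convergent_subseq:
  fixes f :: "nat \<Rightarrow> complex"
  assumes "\<And>m. cmod (f m) \<le> B"
  shows "\<exists>r :: nat \<Rightarrow> nat. strict_mono r \<and> convergent (\<lambda>m. f (r m))"
proof -
  have "\<bar>Re (f m)\<bar> \<le> B" for m by (rule order_trans[OF abs_Re_le_cmod assms])
  then obtain r1 where r1: "strict_mono r1" "convergent (\<lambda>m. Re (f (r1 m)))"
    using bounded_real_seq_convergent_subseq[of "\<lambda>m. Re (f m)"] by blast
  have "\<bar>Im (f (r1 m))\<bar> \<le> B" for m by (rule order_trans[OF abs_Im_le_cmod assms])
  then obtain r2 where r2: "strict_mono r2" "convergent (\<lambda>m. Im (f (r1 (r2 m))))"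
    using bounded_real_seq_convergent_subseq[of "\<lambda>m. Im (f (r1 m))"] by blast
  have "convergent (\<lambda>m. Re (f (r1 (r2 m))))"
    using convergent_subseq_convergent[OF r1(2) r2(1)] by (simp add: o_def)
  then obtain a where a: "(\<lambda>m. Re (f (r1 (r2 m)))) \<longlonglongrightarrow> a" by (auto simp: convergent_def)
  obtain b where b: "(\<lambda>m. Im (f (r1 (r2 m)))) \<longlonglongrightarrow> b" using r2 by (auto simp: convergent_def)
  have "(\<lambda>m. f (r1 (r2 m))) \<longlonglongrightarrow> Complex a b" using a b by (simp add: tendsto_complex_iff)
  then show ?thesis using strict_mono_o[OF r1(1) r2(1)]
    unfolding convergent_def by (intro exI[of _ "r1 \<circ> r2"]) auto
qed

text \<open>The subsequence is refined once for every index; refining keeps the limits already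
  obtained.\<close>

lemma bounded_family_convergent_subseq:
  fixes f :: "nat \<Rightarrow> 'i \<Rightarrow> complex"
  assumes "finite I" "\<And>m i. i \<in> I \<Longrightarrow> cmod (f m i) \<le> B"
  shows "\<exists>r :: nat \<Rightarrow> nat. strict_mono r \<and> (\<forall>i\<in>I. convergent (\<lambda>m. f (r m) i))"
  using assms
proof (induction I rule: finite_induct)
  case empty
  then show ?case by (intro exI[of _ id]) (simp add: strict_mono_def)
next
  case (insert i I)
  then obtain r where r: "strict_mono r" "\<forall>i\<in>I. convergent (\<lambda>m. f (r m) i)" by blast
  have "cmod (f (r m) i) \<le> B" for m using insert.prems by blast
  then obtain r' where r': "strict_mono r'" "convergent (\<lambda>m. f (r (r' m)) i)"
    using bounded_complex_seq_convergent_subseq[of "\<lambda>m. f (r m) i" B] by blast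
  have "convergent (\<lambda>m. f (r (r' m)) i')" if "i' \<in> I" for i'
  proof -
    have "convergent (\<lambda>m. f (r m) i')" using r(2) that by blast
    from convergent_subseq_convergent[OF this r'(1)] show ?thesis by (simp add: o_def)
  qed
  then have "\<forall>i'\<in>insert i I. convergent (\<lambda>m. f ((r \<circ> r') m) i')" using r'(2) by simp
  then show ?case using strict_mono_o[OF r(1) r'(1)] by blast
qed

section \<open>Monotonicity under LOCC\<close>

lemma sum_mats_carrier [simp]:
  "(\<And>M. M \<in> set Ms \<Longrightarrow> M \<in> carrier_mat nr nc) \<Longrightarrow> sum_mats nr nc Ms \<in> carrier_mat nr nc"
  by (induction Ms) (auto simp: sum_mats_def)

lemma sum_mats_index:
  "(\<And>M. M \<in> set Ms \<Longrightarrow> M \<in> carrier_mat nr nc) \<Longrightarrow> i < nr \<Longrightarrow> j < nc \<Longrightarrow>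
    sum_mats nr nc Ms $$ (i, j) = (\<Sum>M\<leftarrow>Ms. M $$ (i, j))"
proof (induction Ms)
  case (Cons M Ms)
  have "sum_mats nr nc Ms \<in> carrier_mat nr nc" using Cons.prems by (intro sum_mats_carrier) auto
  then have "(M + sum_mats nr nc Ms) $$ (i, j) = M $$ (i, j) + sum_mats nr nc Ms $$ (i, j)"
    using Cons.prems(2,3) by (intro index_add_mat) auto
  then show ?case using Cons by (simp add: sum_mats_def)
qed (simp add: sum_mats_def)

text \<open>An ensemble whose probabilities are absorbed into the norms of its vectors. A list keeps
  repeated vectors with their multiplicity.\<close>

definition mixture :: "nat \<Rightarrow> complex vec list \<Rightarrow> complex mat" where
  "mixture d vs = sum_mats d d (map projector vs)"

lemma projector_carrier [simp]: "v \<in> carrier_vec d \<Longrightarrow> projector v \<in> carrier_mat d d"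
  by (auto simp: projector_def)

lemma mixture_carrier [simp]: "set vs \<subseteq> carrier_vec d \<Longrightarrow> mixture d vs \<in> carrier_mat d d"
  unfolding mixture_def by (rule sum_mats_carrier) auto

lemma mixture_index:
  assumes "set vs \<subseteq> carrier_vec d" "i < d" "j < d"
  shows "mixture d vs $$ (i, j) = (\<Sum>v\<leftarrow>vs. v $ i * cnj (v $ j))"
proof -
  have "mixture d vs $$ (i, j) = (\<Sum>v\<leftarrow>vs. projector v $$ (i, j))"
    unfolding mixture_def using assms by (subst sum_mats_index) (auto simp: o_def)
  also have "\<dots> = (\<Sum>v\<leftarrow>vs. v $ i * cnj (v $ j))"
    using assms by (intro arg_cong[of _ _ sum_list] map_cong) (auto simp: projector_def)
  finally show ?thesis .
qed

lemma sum_list_concat_map: "(\<Sum>x\<leftarrow>concat xss. f x) = (\<Sum>xs\<leftarrow>xss. \<Sum>x\<leftarrow>xs. f x)"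
  for f :: "'a \<Rightarrow> 'b :: comm_monoid_add"
  by (induction xss) auto

lemma mixture_concat:
  assumes "\<And>i. i \<in> set is \<Longrightarrow> set (ws i) \<subseteq> carrier_vec d"
  shows "sum_mats d d (map (\<lambda>i. mixture d (ws i)) is) = mixture d (concat (map ws is))"
proof (rule eq_matI)
  have c: "set (concat (map ws is)) \<subseteq> carrier_vec d" using assms by auto
  have s: "sum_mats d d (map (\<lambda>i. mixture d (ws i)) is) \<in> carrier_mat d d"
    using assms by (intro sum_mats_carrier) auto
  show "dim_row (sum_mats d d (map (\<lambda>i. mixture d (ws i)) is)) = dim_row (mixture d (concat (map ws is)))"
    "dim_col (sum_mats d d (map (\<lambda>i. mixture d (ws i)) is)) = dim_col (mixture d (concat (map ws is)))"
    using s mixture_carrier[OF c] by auto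
  fix i j assume "i < dim_row (mixture d (concat (map ws is)))" "j < dim_col (mixture d (concat (map ws is)))"
  then have ij: "i < d" "j < d" using mixture_carrier[OF c] by auto
  have "sum_mats d d (map (\<lambda>i. mixture d (ws i)) is) $$ (i, j)
    = (\<Sum>k\<leftarrow>is. mixture d (ws k) $$ (i, j))"
    using ij assms by (subst sum_mats_index) (auto simp: o_def)
  also have "\<dots> = (\<Sum>k\<leftarrow>is. \<Sum>v\<leftarrow>ws k. v $ i * cnj (v $ j))"
    using ij assms by (intro arg_cong[of _ _ sum_list] map_cong) (auto simp: mixture_index)
  also have "\<dots> = mixture d (concat (map ws is)) $$ (i, j)"
    unfolding mixture_index[OF c ij] by (simp add: sum_list_concat_map o_def)
  finally show "sum_mats d d (map (\<lambda>i. mixture d (ws i)) is) $$ (i, j) = mixture d (concat (map ws is)) $$ (i, j)" .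
qed

lemma kraus_projector:
  assumes K: "K \<in> carrier_mat d' d" and v: "v \<in> carrier_vec d"
  shows "K * projector v * mat_adjoint K = projector (K *\<^sub>v v)"
proof (rule eq_matI)
  fix i j assume "i < dim_row (projector (K *\<^sub>v v))" "j < dim_col (projector (K *\<^sub>v v))"
  then have ij: "i < d'" "j < d'" using K by (auto simp: projector_def)
  have "(K * projector v * mat_adjoint K) $$ (i, j)
    = (\<Sum>l<d. (\<Sum>k<d. K $$ (i, k) * (v $ k * cnj (v $ l))) * cnj (K $$ (j, l)))"
    using K v ij by (simp add: scalar_prod_def atLeast0LessThan projector_def)
  also have "\<dots> = (\<Sum>l<d. \<Sum>k<d. (K $$ (i, k) * v $ k) * cnj (K $$ (j, l) * v $ l))"
    by (simp add: sum_distrib_left sum_distrib_right mult_ac)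
  also have "\<dots> = (\<Sum>k<d. K $$ (i, k) * v $ k) * cnj (\<Sum>l<d. K $$ (j, l) * v $ l)"
    unfolding cnj_sum sum_product by (rule sum.swap)
  also have "\<dots> = projector (K *\<^sub>v v) $$ (i, j)"
    using K v ij by (simp add: scalar_prod_def atLeast0LessThan projector_def)
  finally show "(K * projector v * mat_adjoint K) $$ (i, j) = projector (K *\<^sub>v v) $$ (i, j)" .
qed (use K in \<open>auto simp: projector_def\<close>)

lemma kraus_mixture:
  assumes K: "K \<in> carrier_mat d' d" and vs: "set vs \<subseteq> carrier_vec d"
  shows "K * mixture d vs * mat_adjoint K = mixture d' (map (\<lambda>v. K *\<^sub>v v) vs)"
  using vs
proof (induction vs)
  case Nil
  then show ?case using K by (simp add: mixture_def sum_mats_def)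
next
  case (Cons v vs)
  have c: "projector v \<in> carrier_mat d d" "mixture d vs \<in> carrier_mat d d"
    "mat_adjoint K \<in> carrier_mat d d'"
    using Cons.prems K by auto
  have "K * mixture d (v # vs) * mat_adjoint K = K * (projector v + mixture d vs) * mat_adjoint K"
    by (simp add: mixture_def sum_mats_def)
  also have "\<dots> = K * projector v * mat_adjoint K + K * mixture d vs * mat_adjoint K"
    using c K by (simp add: mult_add_distrib_mat[of _ d' d _ d] add_mult_distrib_mat[of _ d' d _ _ d'])
  also have "\<dots> = mixture d' (map (\<lambda>v. K *\<^sub>v v) (v # vs))"
    using Cons K kraus_projector[OF K, of v] by (simp add: mixture_def sum_mats_def)
  finally show ?case .
qed

lemma apply_kraus_mixture:
  assumes Ks: "\<And>K. K \<in> set Ks \<Longrightarrow> K \<in> carrier_mat d' d" and vs: "set vs \<subseteq> carrier_vec d"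
  shows "apply_kraus d' Ks (mixture d vs) = mixture d' (concat (map (\<lambda>K. map (\<lambda>v. K *\<^sub>v v) vs) Ks))"
proof -
  have "apply_kraus d' Ks (mixture d vs) = sum_mats d' d' (map (\<lambda>K. mixture d' (map (\<lambda>v. K *\<^sub>v v) vs)) Ks)"
    unfolding apply_kraus_def
    by (intro arg_cong[of _ _ "sum_mats d' d'"] map_cong refl kraus_mixture[OF Ks vs])
  also have "\<dots> = mixture d' (concat (map (\<lambda>K. map (\<lambda>v. K *\<^sub>v v) vs) Ks))"
  proof (rule mixture_concat)
    fix K assume "K \<in> set Ks"
    from mult_mat_vec_carrier[OF Ks[OF this]] vs
    show "set (map ((*\<^sub>v) K) vs) \<subseteq> carrier_vec d'" by auto
  qed
  finally show ?thesis .
qed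

section \<open>Local operators in product coordinates\<close>

lemma kron_carrier [simp]:
  "A \<in> carrier_mat mA dA \<Longrightarrow> B \<in> carrier_mat mB dB \<Longrightarrow> kron A B \<in> carrier_mat (mA * mB) (dA * dB)"
  by (auto simp: kron_def)

lemma kron_mult_vec:
  assumes A: "A \<in> carrier_mat mA dA" and B: "B \<in> carrier_mat mB dB" and v: "v \<in> carrier_vec (dA * dB)"
    and ab: "a < mA" "b < mB"
  shows "(kron A B *\<^sub>v v) $ (a * mB + b)
    = (\<Sum>a'<dA. \<Sum>b'<dB. A $$ (a, a') * B $$ (b, b') * v $ (a' * dB + b'))"
proof -
  have lt: "a * mB + b < mA * mB" by (rule product_index_less[OF ab])
  have "(kron A B *\<^sub>v v) $ (a * mB + b) = (\<Sum>j<dA * dB. kron A B $$ (a * mB + b, j) * v $ j)"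
    using kron_carrier[OF A B] v lt by (simp add: scalar_prod_def atLeast0LessThan)
  also have "\<dots> = (\<Sum>a'<dA. \<Sum>b'<dB. kron A B $$ (a * mB + b, a' * dB + b') * v $ (a' * dB + b'))"
    by (rule sum_product_index)
  also have "\<dots> = (\<Sum>a'<dA. \<Sum>b'<dB. A $$ (a, a') * B $$ (b, b') * v $ (a' * dB + b'))"
  proof (intro sum.cong refl)
    fix a' b' assume "a' \<in> {..<dA}" "b' \<in> {..<dB}"
    then have "a' < dA" "b' < dB" by auto
    then show "kron A B $$ (a * mB + b, a' * dB + b') * v $ (a' * dB + b')
      = A $$ (a, a') * B $$ (b, b') * v $ (a' * dB + b')"
      using A B ab lt product_index_less[of a' dA b' dB] by (simp add: kron_def)
  qed
  finally show ?thesis .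
qed

text \<open>By the completeness relation the operators stacked on top of each other form an
  isometry. Their numbers of rows may differ, which is why the inner sum runs to
  \<open>dim_row K\<close>.\<close>

lemma kraus_isometry:
  fixes y :: "nat \<Rightarrow> complex"
  assumes Ks: "\<And>K. K \<in> set Ks \<Longrightarrow> dim_col K = d"
    and one: "sum_mats d d (map (\<lambda>K. mat_adjoint K * K) Ks) = 1\<^sub>m d"
  shows "(\<Sum>K\<leftarrow>Ks. \<Sum>a<dim_row K. (cmod (\<Sum>i<d. K $$ (a, i) * y i))\<^sup>2) = (\<Sum>i<d. (cmod (y i))\<^sup>2)"
proof -
  have ent: "(\<Sum>K\<leftarrow>Ks. \<Sum>a<dim_row K. cnj (K $$ (a, j)) * K $$ (a, i)) = (if i = j then 1 else 0)"
    if "i < d" "j < d" for i j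
  proof -
    have "(\<Sum>K\<leftarrow>Ks. (mat_adjoint K * K) $$ (j, i)) = (if i = j then 1 else 0)"
      using arg_cong[OF one, of "\<lambda>M. M $$ (j, i)"] that Ks
      by (subst (asm) sum_mats_index) (auto simp: o_def)
    moreover have "(\<Sum>K\<leftarrow>Ks. (mat_adjoint K * K) $$ (j, i)) = (\<Sum>K\<leftarrow>Ks. \<Sum>a<dim_row K. cnj (K $$ (a, j)) * K $$ (a, i))"
      using Ks that by (intro arg_cong[of _ _ sum_list] map_cong) (auto simp: scalar_prod_def atLeast0LessThan)
    ultimately show ?thesis by simp
  qed
  have swap: "(\<Sum>K\<leftarrow>Ks. \<Sum>i<d. f K i) = (\<Sum>i<d. \<Sum>K\<leftarrow>Ks. f K i)" for f :: "complex mat \<Rightarrow> nat \<Rightarrow> complex"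
    by (induction Ks) (auto simp: sum.distrib)
  have one_K: "complex_of_real (\<Sum>a<dim_row K. (cmod (\<Sum>i<d. K $$ (a, i) * y i))\<^sup>2)
    = (\<Sum>i<d. \<Sum>j<d. (y i * cnj (y j)) * (\<Sum>a<dim_row K. cnj (K $$ (a, j)) * K $$ (a, i)))" for K
  proof -
    have "complex_of_real (\<Sum>a<dim_row K. (cmod (\<Sum>i<d. K $$ (a, i) * y i))\<^sup>2)
      = (\<Sum>a<dim_row K. \<Sum>i<d. \<Sum>j<d. (y i * cnj (y j)) * (cnj (K $$ (a, j)) * K $$ (a, i)))"
      unfolding of_real_sum complex_norm_square cnj_sum sum_product by (simp add: mult_ac)
    also have "\<dots> = (\<Sum>i<d. \<Sum>a<dim_row K. \<Sum>j<d. (y i * cnj (y j)) * (cnj (K $$ (a, j)) * K $$ (a, i)))"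
      by (rule sum.swap)
    also have "\<dots> = (\<Sum>i<d. \<Sum>j<d. \<Sum>a<dim_row K. (y i * cnj (y j)) * (cnj (K $$ (a, j)) * K $$ (a, i)))"
      by (intro sum.cong refl sum.swap)
    finally show ?thesis by (simp add: sum_distrib_left)
  qed
  have "complex_of_real (\<Sum>K\<leftarrow>Ks. \<Sum>a<dim_row K. (cmod (\<Sum>i<d. K $$ (a, i) * y i))\<^sup>2)
    = (\<Sum>K\<leftarrow>Ks. complex_of_real (\<Sum>a<dim_row K. (cmod (\<Sum>i<d. K $$ (a, i) * y i))\<^sup>2))"
    by (induction Ks) auto
  also have "\<dots> = (\<Sum>i<d. \<Sum>j<d. (y i * cnj (y j)) * (\<Sum>K\<leftarrow>Ks. \<Sum>a<dim_row K. cnj (K $$ (a, j)) * K $$ (a, i)))"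
    unfolding one_K swap by (simp add: sum_list_const_mult)
  also have "\<dots> = (\<Sum>i<d. \<Sum>j<d. if j = i then y i * cnj (y i) else 0)"
    by (intro sum.cong refl) (auto simp: ent)
  also have "\<dots> = complex_of_real (\<Sum>i<d. (cmod (y i))\<^sup>2)"
    unfolding of_real_sum complex_norm_square by simp
  finally show ?thesis using of_real_eq_iff by blast
qed

lemma instrument_kraus:
  assumes "instrument d Es"
  shows "\<And>K. K \<in> set (concat (map snd Es)) \<Longrightarrow> dim_col K = d"
    "sum_mats d d (map (\<lambda>K. mat_adjoint K * K) (concat (map snd Es))) = 1\<^sub>m d"
    "\<And>i K. i < length Es \<Longrightarrow> K \<in> set (snd (Es ! i)) \<Longrightarrow> K \<in> carrier_mat (fst (Es ! i)) d"
proof -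
  show 1: "K \<in> carrier_mat (fst (Es ! i)) d" if "i < length Es" "K \<in> set (snd (Es ! i))" for i K
  proof -
    have "(fst (Es ! i), snd (Es ! i)) \<in> set Es" using that by simp
    then show ?thesis using assms that(2) unfolding instrument_def by blast
  qed
  show "dim_col K = d" if K: "K \<in> set (concat (map snd Es))" for K
  proof -
    obtain E where "E \<in> set Es" "K \<in> set (snd E)" using K by auto
    then obtain i where "i < length Es" "K \<in> set (snd (Es ! i))" by (metis in_set_conv_nth)
    then show ?thesis using 1 by blast
  qed
  show "sum_mats d d (map (\<lambda>K. mat_adjoint K * K) (concat (map snd Es))) = 1\<^sub>m d"
    using assms by (simp add: instrument_def)
qed

text \<open>The output dimension is stored with the outcome; reading it off as
  \<open>dim_row K\<close> makes it possible to treat all Kraus operators of the instrument as one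
  list, as the completeness relation does.\<close>

lemma instrument_sum:
  fixes f :: "nat \<Rightarrow> complex mat \<Rightarrow> real"
  assumes "instrument d Es"
  shows "(\<Sum>i\<leftarrow>[0..<length Es]. \<Sum>K\<leftarrow>snd (Es ! i). f (fst (Es ! i)) K)
    = (\<Sum>K\<leftarrow>concat (map snd Es). f (dim_row K) K)"
proof -
  have "(\<Sum>K\<leftarrow>concat (map snd Es). f (dim_row K) K) = (\<Sum>i\<leftarrow>[0..<length Es]. \<Sum>K\<leftarrow>snd (Es ! i). f (dim_row K) K)"
  proof -
    have "map snd Es = map (\<lambda>i. snd (Es ! i)) [0..<length Es]" by (intro nth_equalityI) auto
    then show ?thesis unfolding sum_list_concat_map by (simp add: o_def)
  qed
  also have "\<dots> = (\<Sum>i\<leftarrow>[0..<length Es]. \<Sum>K\<leftarrow>snd (Es ! i). f (fst (Es ! i)) K)"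
  proof (intro arg_cong[of _ _ sum_list] map_cong refl)
    fix i K assume "i \<in> set [0..<length Es]" "K \<in> set (snd (Es ! i))"
    then show "f (dim_row K) K = f (fst (Es ! i)) K"
      using instrument_kraus(3)[OF assms, of i K] by auto
  qed
  finally show ?thesis by simp
qed

lemma sum_list_sum_swap: "(\<Sum>K\<leftarrow>Ks. \<Sum>b<d. f K b) = (\<Sum>b<d. \<Sum>K\<leftarrow>Ks. f K b)"
  for f :: "'a \<Rightarrow> nat \<Rightarrow> real"
  by (induction Ks) (auto simp: sum.distrib)

lemma kron_one_right_mult_vec:
  assumes A: "A \<in> carrier_mat mA dA" and v: "v \<in> carrier_vec (dA * dB)" and ab: "a < mA" "b < dB"
  shows "(kron A (1\<^sub>m dB) *\<^sub>v v) $ (a * dB + b) = (\<Sum>a'<dA. A $$ (a, a') * v $ (a' * dB + b))"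
proof -
  have "(\<Sum>b'<dB. A $$ (a, a') * 1\<^sub>m dB $$ (b, b') * v $ (a' * dB + b')) = A $$ (a, a') * v $ (a' * dB + b)" for a'
  proof -
    have "(\<Sum>b'<dB. A $$ (a, a') * 1\<^sub>m dB $$ (b, b') * v $ (a' * dB + b'))
      = (\<Sum>b'<dB. if b' = b then A $$ (a, a') * v $ (a' * dB + b) else 0)"
      using ab by (intro sum.cong) auto
    then show ?thesis using ab by simp
  qed
  then show ?thesis using kron_mult_vec[OF A one_carrier_mat[of dB] v ab] by simp
qed

lemma kron_one_left_mult_vec:
  assumes B: "B \<in> carrier_mat mB dB" and v: "v \<in> carrier_vec (dA * dB)" and ab: "a < dA" "b < mB"
  shows "(kron (1\<^sub>m dA) B *\<^sub>v v) $ (a * mB + b) = (\<Sum>b'<dB. B $$ (b, b') * v $ (a * dB + b'))"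
proof -
  have "(kron (1\<^sub>m dA) B *\<^sub>v v) $ (a * mB + b)
    = (\<Sum>a'<dA. \<Sum>b'<dB. 1\<^sub>m dA $$ (a, a') * B $$ (b, b') * v $ (a' * dB + b'))"
    by (rule kron_mult_vec[OF one_carrier_mat B v ab])
  also have "\<dots> = (\<Sum>a'<dA. if a' = a then \<Sum>b'<dB. B $$ (b, b') * v $ (a * dB + b') else 0)"
    using ab by (intro sum.cong) auto
  finally show ?thesis using ab by simp
qed

text \<open>Alice's Kraus operators send a rank-\<open>l\<close> approximation \<open>x\<close> of \<open>v\<close> to rank-\<open>l\<close> approximations
  of the branches and preserve the total squared norm of \<open>v - x\<close>; likewise for Bob.\<close>

lemma schmidt_tail_alice:
  assumes inst: "instrument dA Es" and v: "v \<in> carrier_vec (dA * dB)"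
  shows "(\<Sum>K\<leftarrow>concat (map snd Es). schmidt_tail (dim_row K) dB l (kron K (1\<^sub>m dB) *\<^sub>v v)) \<le> schmidt_tail dA dB l v"
proof (rule schmidt_tail_geI)
  fix BC :: "(nat \<Rightarrow> nat \<Rightarrow> complex) \<times> (nat \<Rightarrow> nat \<Rightarrow> complex)"
  define y where "y b a = v $ (a * dB + b) - (\<Sum>k<l. fst BC a k * snd BC k b)" for a b
  note Ks = instrument_kraus(1,2)[OF inst]
  let ?Ks = "concat (map snd Es)"
  have "schmidt_tail (dim_row K) dB l (kron K (1\<^sub>m dB) *\<^sub>v v)
    \<le> (\<Sum>b<dB. \<Sum>a<dim_row K. (cmod (\<Sum>i<dA. K $$ (a, i) * y b i))\<^sup>2)" if "K \<in> set ?Ks" for K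
  proof -
    have K: "K \<in> carrier_mat (dim_row K) dA" using Ks(1)[OF that] by auto
    let ?BC = "(\<lambda>a k. \<Sum>i<dA. K $$ (a, i) * fst BC i k, snd BC)"
    have "(kron K (1\<^sub>m dB) *\<^sub>v v) $ (a * dB + b) - (\<Sum>k<l. fst ?BC a k * snd ?BC k b)
      = (\<Sum>i<dA. K $$ (a, i) * y b i)" if "a < dim_row K" "b < dB" for a b
    proof -
      have "(\<Sum>k<l. fst ?BC a k * snd ?BC k b) = (\<Sum>k<l. \<Sum>i<dA. K $$ (a, i) * (fst BC i k * snd BC k b))"
        by (simp add: sum_distrib_right mult.assoc)
      also have "\<dots> = (\<Sum>i<dA. K $$ (a, i) * (\<Sum>k<l. fst BC i k * snd BC k b))"
        by (subst sum.swap) (simp add: sum_distrib_left)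
      finally show ?thesis
        unfolding kron_one_right_mult_vec[OF K v that] y_def right_diff_distrib sum_subtractf by simp
    qed
    then have "rank_error (dim_row K) dB l (kron K (1\<^sub>m dB) *\<^sub>v v) ?BC
      = (\<Sum>a<dim_row K. \<Sum>b<dB. (cmod (\<Sum>i<dA. K $$ (a, i) * y b i))\<^sup>2)"
      unfolding rank_error_def by (intro sum.cong refl) auto
    also have "\<dots> = (\<Sum>b<dB. \<Sum>a<dim_row K. (cmod (\<Sum>i<dA. K $$ (a, i) * y b i))\<^sup>2)" by (rule sum.swap)
    finally show ?thesis using schmidt_tail_le[of "dim_row K" dB l "kron K (1\<^sub>m dB) *\<^sub>v v" ?BC] by linarith
  qed
  then have "(\<Sum>K\<leftarrow>?Ks. schmidt_tail (dim_row K) dB l (kron K (1\<^sub>m dB) *\<^sub>v v))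
    \<le> (\<Sum>K\<leftarrow>?Ks. \<Sum>b<dB. \<Sum>a<dim_row K. (cmod (\<Sum>i<dA. K $$ (a, i) * y b i))\<^sup>2)"
    by (rule sum_list_mono)
  also have "\<dots> = (\<Sum>b<dB. \<Sum>a<dA. (cmod (y b a))\<^sup>2)"
    unfolding sum_list_sum_swap by (intro sum.cong refl kraus_isometry[OF Ks])
  also have "\<dots> = (\<Sum>a<dA. \<Sum>b<dB. (cmod (y b a))\<^sup>2)" by (rule sum.swap)
  also have "\<dots> = rank_error dA dB l v BC" by (simp add: rank_error_def y_def)
  finally show "(\<Sum>K\<leftarrow>?Ks. schmidt_tail (dim_row K) dB l (kron K (1\<^sub>m dB) *\<^sub>v v)) \<le> rank_error dA dB l v BC" .
qed

lemma schmidt_tail_bob: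
  assumes inst: "instrument dB Es" and v: "v \<in> carrier_vec (dA * dB)"
  shows "(\<Sum>K\<leftarrow>concat (map snd Es). schmidt_tail dA (dim_row K) l (kron (1\<^sub>m dA) K *\<^sub>v v)) \<le> schmidt_tail dA dB l v"
proof (rule schmidt_tail_geI)
  fix BC :: "(nat \<Rightarrow> nat \<Rightarrow> complex) \<times> (nat \<Rightarrow> nat \<Rightarrow> complex)"
  define y where "y a b = v $ (a * dB + b) - (\<Sum>k<l. fst BC a k * snd BC k b)" for a b
  note Ks = instrument_kraus(1,2)[OF inst]
  let ?Ks = "concat (map snd Es)"
  have "schmidt_tail dA (dim_row K) l (kron (1\<^sub>m dA) K *\<^sub>v v)
    \<le> (\<Sum>a<dA. \<Sum>b<dim_row K. (cmod (\<Sum>i<dB. K $$ (b, i) * y a i))\<^sup>2)" if "K \<in> set ?Ks" for K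
  proof -
    have K: "K \<in> carrier_mat (dim_row K) dB" using Ks(1)[OF that] by auto
    let ?BC = "(fst BC, \<lambda>k b. \<Sum>i<dB. K $$ (b, i) * snd BC k i)"
    have "(kron (1\<^sub>m dA) K *\<^sub>v v) $ (a * dim_row K + b) - (\<Sum>k<l. fst ?BC a k * snd ?BC k b)
      = (\<Sum>i<dB. K $$ (b, i) * y a i)" if "a < dA" "b < dim_row K" for a b
    proof -
      have "(\<Sum>k<l. fst ?BC a k * snd ?BC k b) = (\<Sum>k<l. \<Sum>i<dB. K $$ (b, i) * (fst BC a k * snd BC k i))"
        by (simp add: sum_distrib_left mult_ac)
      also have "\<dots> = (\<Sum>i<dB. K $$ (b, i) * (\<Sum>k<l. fst BC a k * snd BC k i))"
        by (subst sum.swap) (simp add: sum_distrib_left)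
      finally show ?thesis
        unfolding kron_one_left_mult_vec[OF K v that] y_def right_diff_distrib sum_subtractf by simp
    qed
    then have "rank_error dA (dim_row K) l (kron (1\<^sub>m dA) K *\<^sub>v v) ?BC
      = (\<Sum>a<dA. \<Sum>b<dim_row K. (cmod (\<Sum>i<dB. K $$ (b, i) * y a i))\<^sup>2)"
      unfolding rank_error_def by (intro sum.cong refl) auto
    then show ?thesis using schmidt_tail_le[of dA "dim_row K" l "kron (1\<^sub>m dA) K *\<^sub>v v" ?BC] by linarith
  qed
  then have "(\<Sum>K\<leftarrow>?Ks. schmidt_tail dA (dim_row K) l (kron (1\<^sub>m dA) K *\<^sub>v v))
    \<le> (\<Sum>K\<leftarrow>?Ks. \<Sum>a<dA. \<Sum>b<dim_row K. (cmod (\<Sum>i<dB. K $$ (b, i) * y a i))\<^sup>2)"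
    by (rule sum_list_mono)
  also have "\<dots> = (\<Sum>a<dA. \<Sum>b<dB. (cmod (y a b))\<^sup>2)"
    unfolding sum_list_sum_swap by (intro sum.cong refl kraus_isometry[OF Ks])
  also have "\<dots> = rank_error dA dB l v BC" by (simp add: rank_error_def y_def)
  finally show "(\<Sum>K\<leftarrow>?Ks. schmidt_tail dA (dim_row K) l (kron (1\<^sub>m dA) K *\<^sub>v v)) \<le> rank_error dA dB l v BC" .
qed

lemma sum_list_swap: "(\<Sum>x\<leftarrow>xs. \<Sum>y\<leftarrow>ys. f x y) = (\<Sum>y\<leftarrow>ys. \<Sum>x\<leftarrow>xs. f x y)"
  for f :: "'a \<Rightarrow> 'b \<Rightarrow> real"
  by (induction xs) (auto simp: sum_list_addf)

text \<open>The induction step common to both parties: \<open>F K\<close> is \<open>K\<close> tensored with the identity of the other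
  party, and \<open>D m\<close> is the total dimension once the acting party holds an \<open>m\<close>-dimensional system.\<close>

lemma locc_round:
  assumes inst: "instrument d Es"
    and F: "\<And>i K. i < length Es \<Longrightarrow> K \<in> set (snd (Es ! i)) \<Longrightarrow> F K \<in> carrier_mat (D (fst (Es ! i))) d0"
    and branch: "\<And>i vs. i < length Es \<Longrightarrow> set vs \<subseteq> carrier_vec (D (fst (Es ! i))) \<Longrightarrow>
      \<exists>ws. set ws \<subseteq> carrier_vec d1 \<and> P i (mixture (D (fst (Es ! i))) vs) = mixture d1 ws \<and>
        (\<forall>l. (\<Sum>w\<leftarrow>ws. t l w) \<le> (\<Sum>v\<leftarrow>vs. T (fst (Es ! i)) l v))"
    and tail: "\<And>l v. v \<in> carrier_vec d0 \<Longrightarrow> (\<Sum>K\<leftarrow>concat (map snd Es). T (dim_row K) l (F K *\<^sub>v v)) \<le> (T0 l v :: real)"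
    and vs: "set vs \<subseteq> carrier_vec d0"
  shows "\<exists>ws. set ws \<subseteq> carrier_vec d1 \<and>
    sum_mats d1 d1 (map (\<lambda>i. P i (apply_kraus (D (fst (Es ! i))) (map F (snd (Es ! i))) (mixture d0 vs))) [0..<length Es])
      = mixture d1 ws \<and> (\<forall>l. (\<Sum>w\<leftarrow>ws. t l w) \<le> (\<Sum>v\<leftarrow>vs. T0 l v))"
proof -
  define us where "us i = concat (map (\<lambda>K. map (\<lambda>v. F K *\<^sub>v v) vs) (snd (Es ! i)))" for i
  have kraus: "apply_kraus (D (fst (Es ! i))) (map F (snd (Es ! i))) (mixture d0 vs) = mixture (D (fst (Es ! i))) (us i)"
    and us: "set (us i) \<subseteq> carrier_vec (D (fst (Es ! i)))" if "i < length Es" for i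
  proof -
    show "apply_kraus (D (fst (Es ! i))) (map F (snd (Es ! i))) (mixture d0 vs) = mixture (D (fst (Es ! i))) (us i)"
      using apply_kraus_mixture[of "map F (snd (Es ! i))" "D (fst (Es ! i))" d0 vs] F[OF that] vs
      by (auto simp: us_def o_def)
    show "set (us i) \<subseteq> carrier_vec (D (fst (Es ! i)))"
      using F[OF that] vs by (force simp: us_def intro: mult_mat_vec_carrier)
  qed
  have "\<forall>i. \<exists>ws. i < length Es \<longrightarrow> set ws \<subseteq> carrier_vec d1 \<and>
      P i (mixture (D (fst (Es ! i))) (us i)) = mixture d1 ws \<and>
      (\<forall>l. (\<Sum>w\<leftarrow>ws. t l w) \<le> (\<Sum>v\<leftarrow>us i. T (fst (Es ! i)) l v))"
    using branch[OF _ us] by blast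
  then obtain ws where ws: "\<And>i. i < length Es \<Longrightarrow> set (ws i) \<subseteq> carrier_vec d1"
    "\<And>i. i < length Es \<Longrightarrow> P i (mixture (D (fst (Es ! i))) (us i)) = mixture d1 (ws i)"
    "\<And>i l. i < length Es \<Longrightarrow> (\<Sum>w\<leftarrow>ws i. t l w) \<le> (\<Sum>v\<leftarrow>us i. T (fst (Es ! i)) l v)"
    by metis
  have "sum_mats d1 d1 (map (\<lambda>i. P i (apply_kraus (D (fst (Es ! i))) (map F (snd (Es ! i))) (mixture d0 vs))) [0..<length Es])
    = sum_mats d1 d1 (map (\<lambda>i. mixture d1 (ws i)) [0..<length Es])"
    by (intro arg_cong[of _ _ "sum_mats d1 d1"] map_cong) (auto simp: kraus ws(2))
  also have "\<dots> = mixture d1 (concat (map ws [0..<length Es]))"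
    by (rule mixture_concat) (use ws(1) in auto)
  finally have eq: "sum_mats d1 d1 (map (\<lambda>i. P i (apply_kraus (D (fst (Es ! i))) (map F (snd (Es ! i))) (mixture d0 vs))) [0..<length Es])
    = mixture d1 (concat (map ws [0..<length Es]))" .
  \<comment> \<open>First the estimate for the remaining protocol is applied in each branch; after
    an exchange of the sums, the estimate for the present round is applied to each input vector
    separately.\<close>
  have "(\<Sum>w\<leftarrow>concat (map ws [0..<length Es]). t l w) \<le> (\<Sum>v\<leftarrow>vs. T0 l v)" for l
  proof -
    have "(\<Sum>w\<leftarrow>concat (map ws [0..<length Es]). t l w) = (\<Sum>i\<leftarrow>[0..<length Es]. \<Sum>w\<leftarrow>ws i. t l w)"
      by (simp add: sum_list_concat_map o_def)
    also have "\<dots> \<le> (\<Sum>i\<leftarrow>[0..<length Es]. \<Sum>u\<leftarrow>us i. T (fst (Es ! i)) l u)"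
      by (rule sum_list_mono) (use ws(3) in auto)
    also have "\<dots> = (\<Sum>i\<leftarrow>[0..<length Es]. \<Sum>K\<leftarrow>snd (Es ! i). \<Sum>v\<leftarrow>vs. T (fst (Es ! i)) l (F K *\<^sub>v v))"
      by (simp add: us_def sum_list_concat_map o_def)
    also have "\<dots> = (\<Sum>K\<leftarrow>concat (map snd Es). \<Sum>v\<leftarrow>vs. T (dim_row K) l (F K *\<^sub>v v))"
      by (rule instrument_sum[OF inst, of "\<lambda>m K. \<Sum>v\<leftarrow>vs. T m l (F K *\<^sub>v v)"])
    also have "\<dots> = (\<Sum>v\<leftarrow>vs. \<Sum>K\<leftarrow>concat (map snd Es). T (dim_row K) l (F K *\<^sub>v v))"
      by (rule sum_list_swap)
    also have "\<dots> \<le> (\<Sum>v\<leftarrow>vs. T0 l v)"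
      by (rule sum_list_mono) (use tail vs in auto)
    finally show ?thesis .
  qed
  moreover have "set (concat (map ws [0..<length Es])) \<subseteq> carrier_vec d1"
    using ws(1) by (simp add: UN_subset_iff)
  ultimately show ?thesis using eq by blast
qed

text \<open>Induction on the protocol. The input is a mixture rather than a single vector since
  later rounds start from the branches of earlier ones, and one list \<open>ws\<close> serves all
  \<open>l\<close> at the same time. On failure the empty list works because the tails are
  nonnegative.\<close>

lemma locc_tail_monotone:
  assumes "locc n dA dB E" "set vs \<subseteq> carrier_vec (dA * dB)"
  shows "\<exists>ws. set ws \<subseteq> carrier_vec (n * n) \<and> E (mixture (dA * dB) vs) = mixture (n * n) ws \<and>
    (\<forall>l. (\<Sum>w\<leftarrow>ws. schmidt_tail n n l w) \<le> (\<Sum>v\<leftarrow>vs. schmidt_tail dA dB l v))"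
  using assms
proof (induction arbitrary: vs rule: locc.induct)
  case (failure dA dB)
  show ?case
    by (intro exI[of _ "[]"]) (auto simp: mixture_def sum_mats_def intro!: sum_list_nonneg schmidt_tail_nonneg)
next
  case success
  then show ?case by (intro exI[of _ vs]) auto
next
  case (alice dA Es dB P)
  show ?case
  proof (rule locc_round[of dA Es "\<lambda>K. kron K (1\<^sub>m dB)" "\<lambda>m. m * dB" "dA * dB" "n * n" P
        "\<lambda>l. schmidt_tail n n l" "\<lambda>m l. schmidt_tail m dB l" "\<lambda>l. schmidt_tail dA dB l" vs])
    show "kron K (1\<^sub>m dB) \<in> carrier_mat (fst (Es ! i) * dB) (dA * dB)"
      if "i < length Es" "K \<in> set (snd (Es ! i))" for i K
      using instrument_kraus(3)[OF alice(1) that] by simp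
  qed (use alice schmidt_tail_alice in blast)+
next
  case (bob dB Es dA P)
  show ?case
  proof (rule locc_round[of dB Es "\<lambda>K. kron (1\<^sub>m dA) K" "\<lambda>m. dA * m" "dA * dB" "n * n" P
        "\<lambda>l. schmidt_tail n n l" "\<lambda>m l. schmidt_tail dA m l" "\<lambda>l. schmidt_tail dA dB l" vs])
    show "kron (1\<^sub>m dA) K \<in> carrier_mat (dA * fst (Es ! i)) (dA * dB)"
      if "i < length Es" "K \<in> set (snd (Es ! i))" for i K
      using instrument_kraus(3)[OF bob(1) that] by simp
  qed (use bob schmidt_tail_bob in blast)+
qed

section \<open>Rescaling to normalized outputs\<close>

lemma mixture_singleton: "v \<in> carrier_vec d \<Longrightarrow> mixture d [v] = projector v"
  by (simp add: mixture_def sum_mats_def)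

lemma mixture_scale:
  assumes "set vs \<subseteq> carrier_vec d" "0 \<le> c"
  shows "mixture d (map (\<lambda>v. of_real (sqrt c) \<cdot>\<^sub>v v) vs) = of_real c \<cdot>\<^sub>m mixture d vs"
proof (rule eq_matI)
  have c: "set (map (\<lambda>v. of_real (sqrt c) \<cdot>\<^sub>v v) vs) \<subseteq> carrier_vec d" using assms(1) by auto
  note m = mixture_carrier[OF assms(1)] mixture_carrier[OF c]
  show "dim_row (mixture d (map (\<lambda>v. of_real (sqrt c) \<cdot>\<^sub>v v) vs)) = dim_row (of_real c \<cdot>\<^sub>m mixture d vs)"
    "dim_col (mixture d (map (\<lambda>v. of_real (sqrt c) \<cdot>\<^sub>v v) vs)) = dim_col (of_real c \<cdot>\<^sub>m mixture d vs)"
    using m by auto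
  fix i j assume "i < dim_row (of_real c \<cdot>\<^sub>m mixture d vs)" "j < dim_col (of_real c \<cdot>\<^sub>m mixture d vs)"
  then have ij: "i < d" "j < d" using m by auto
  have sq: "complex_of_real (sqrt c) * complex_of_real (sqrt c) = of_real c"
    using assms(2) by (simp flip: of_real_mult)
  have "mixture d (map (\<lambda>v. of_real (sqrt c) \<cdot>\<^sub>v v) vs) $$ (i, j)
    = (\<Sum>v\<leftarrow>vs. (of_real (sqrt c) \<cdot>\<^sub>v v) $ i * cnj ((of_real (sqrt c) \<cdot>\<^sub>v v) $ j))"
    unfolding mixture_index[OF c ij] by (simp add: o_def)
  also have "\<dots> = (\<Sum>v\<leftarrow>vs. of_real c * (v $ i * cnj (v $ j)))"
    using assms(1) ij by (intro arg_cong[of _ _ sum_list] map_cong refl) (auto simp flip: sq)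
  also have "\<dots> = (of_real c \<cdot>\<^sub>m mixture d vs) $$ (i, j)"
    using m ij by (simp add: mixture_index[OF assms(1) ij] sum_list_const_mult)
  finally show "mixture d (map (\<lambda>v. of_real (sqrt c) \<cdot>\<^sub>v v) vs) $$ (i, j) = (of_real c \<cdot>\<^sub>m mixture d vs) $$ (i, j)" .
qed

text \<open>Approximations of \<open>v\<close> are scaled together with \<open>v\<close>, which
  multiplies their errors by \<open>c\<close>.\<close>

lemma schmidt_tail_scale:
  assumes v: "v \<in> carrier_vec (dA * dB)" and c: "0 < c"
  shows "schmidt_tail dA dB l (of_real (sqrt c) \<cdot>\<^sub>v v) \<le> c * schmidt_tail dA dB l v"
proof -
  have "schmidt_tail dA dB l (of_real (sqrt c) \<cdot>\<^sub>v v) / c \<le> rank_error dA dB l v BC" for BC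
  proof -
    let ?BC = "(\<lambda>a k. of_real (sqrt c) * fst BC a k, snd BC)"
    have "(cmod ((of_real (sqrt c) \<cdot>\<^sub>v v) $ (a * dB + b) - (\<Sum>k<l. fst ?BC a k * snd ?BC k b)))\<^sup>2
      = c * (cmod (v $ (a * dB + b) - (\<Sum>k<l. fst BC a k * snd BC k b)))\<^sup>2" if "a < dA" "b < dB" for a b
    proof -
      have "(of_real (sqrt c) \<cdot>\<^sub>v v) $ (a * dB + b) - (\<Sum>k<l. fst ?BC a k * snd ?BC k b)
        = of_real (sqrt c) * (v $ (a * dB + b) - (\<Sum>k<l. fst BC a k * snd BC k b))"
        using v product_index_less[OF that] by (simp add: right_diff_distrib sum_distrib_left mult.assoc)
      then show ?thesis using c by (simp only: norm_mult power_mult_distrib) simp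
    qed
    then have "rank_error dA dB l (of_real (sqrt c) \<cdot>\<^sub>v v) ?BC = c * rank_error dA dB l v BC"
      unfolding rank_error_def sum_distrib_left by (intro sum.cong refl) auto
    then show ?thesis
      using schmidt_tail_le[of dA dB l "of_real (sqrt c) \<cdot>\<^sub>v v" ?BC] c by (simp add: field_simps)
  qed
  then have "schmidt_tail dA dB l (of_real (sqrt c) \<cdot>\<^sub>v v) / c \<le> schmidt_tail dA dB l v"
    by (rule schmidt_tail_geI)
  then show ?thesis using c by (simp add: field_simps)
qed

text \<open>The protocol produces \<open>r\<close> times the state \<open>\<sigma>'\<close>, so each
  resulting vector is divided by \<open>sqrt r\<close>. In this form the bounds of two successive
  protocols can be chained.\<close>

lemma obtainable_tail_monotone:
  assumes ob: "obtainable n (mixture (n * n) vs) \<sigma>' r" and r: "0 < r"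
    and vs: "set vs \<subseteq> carrier_vec (n * n)" and \<sigma>': "\<sigma>' \<in> carrier_mat (n * n) (n * n)"
  shows "\<exists>ws. set ws \<subseteq> carrier_vec (n * n) \<and> \<sigma>' = mixture (n * n) ws \<and>
    (\<forall>l. r * (\<Sum>w\<leftarrow>ws. schmidt_tail n n l w) \<le> (\<Sum>v\<leftarrow>vs. schmidt_tail n n l v))"
proof -
  obtain E where E: "locc n n n E" "E (mixture (n * n) vs) = of_real r \<cdot>\<^sub>m \<sigma>'"
    using ob by (auto simp: obtainable_def)
  obtain ws where ws: "set ws \<subseteq> carrier_vec (n * n)" "E (mixture (n * n) vs) = mixture (n * n) ws"
    "\<forall>l. (\<Sum>w\<leftarrow>ws. schmidt_tail n n l w) \<le> (\<Sum>v\<leftarrow>vs. schmidt_tail n n l v)"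
    using locc_tail_monotone[OF E(1) vs] by blast
  let ?ws = "map (\<lambda>w. of_real (sqrt (1 / r)) \<cdot>\<^sub>v w) ws"
  have "mixture (n * n) ?ws = of_real (1 / r) \<cdot>\<^sub>m (of_real r \<cdot>\<^sub>m \<sigma>')"
    using mixture_scale[OF ws(1), of "1 / r"] r E(2) ws(2) by simp
  also have "\<dots> = \<sigma>'" using r \<sigma>' by (intro eq_matI) auto
  finally have eq: "\<sigma>' = mixture (n * n) ?ws" ..
  have "r * (\<Sum>w\<leftarrow>?ws. schmidt_tail n n l w) \<le> (\<Sum>v\<leftarrow>vs. schmidt_tail n n l v)" for l
  proof -
    have "(\<Sum>w\<leftarrow>?ws. schmidt_tail n n l w) = (\<Sum>w\<leftarrow>ws. schmidt_tail n n l (of_real (sqrt (1 / r)) \<cdot>\<^sub>v w))"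
      by (simp add: o_def)
    also have "\<dots> \<le> (\<Sum>w\<leftarrow>ws. 1 / r * schmidt_tail n n l w)"
      using ws(1) r by (intro sum_list_mono schmidt_tail_scale) auto
    also have "\<dots> = 1 / r * (\<Sum>w\<leftarrow>ws. schmidt_tail n n l w)" by (rule sum_list_const_mult)
    finally have "r * (\<Sum>w\<leftarrow>?ws. schmidt_tail n n l w) \<le> (\<Sum>w\<leftarrow>ws. schmidt_tail n n l w)"
      using r by (simp add: field_simps)
    then show ?thesis using ws(3) by (meson order_trans)
  qed
  moreover have "set ?ws \<subseteq> carrier_vec (n * n)" using ws(1) by auto
  ultimately show ?thesis using eq by blast
qed

lemma schmidt_tail_schmidt_coeffs:
  assumes v: "v \<in> carrier_vec (n * n)" and l: "l \<le> n"
  shows "schmidt_tail n n l v \<le> sum_list (drop l (schmidt_coeffs n v))"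
proof -
  note S = schmidt_decomposition[OF v]
  obtain x y where "schmidt_decomp n v (\<lambda>i. sqrt (schmidt_coeffs n v ! i)) x y" using S(3) by blast
  from schmidt_tail_upper[OF this l]
  have "schmidt_tail n n l v \<le> (\<Sum>i\<in>{l..<n}. schmidt_coeffs n v ! i)" using S(2) by simp
  also have "\<dots> = sum_list (drop l (schmidt_coeffs n v))"
    using S(1) l sum.shift_bounds_nat_ivl[of "\<lambda>i. schmidt_coeffs n v ! i" 0 l "n - l"]
    by (simp add: sum_list_sum_nth add.commute)
  finally show ?thesis .
qed

section \<open>Ensembles of bounded size\<close>

text \<open>The vectors come with their Schmidt decompositions and are indexed by
  \<open>k < N\<close>, so that for fixed \<open>N\<close> all ensembles of a state are described by
  the same finite set of coordinates.\<close>

definition schmidt_ensemble ::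
  "nat \<Rightarrow> nat \<Rightarrow> complex mat \<Rightarrow> (nat \<Rightarrow> complex vec) \<Rightarrow> (nat \<Rightarrow> nat \<Rightarrow> real) \<Rightarrow>
    (nat \<Rightarrow> nat \<Rightarrow> nat \<Rightarrow> complex) \<Rightarrow> (nat \<Rightarrow> nat \<Rightarrow> nat \<Rightarrow> complex) \<Rightarrow> bool" where
  "schmidt_ensemble n N \<rho> v s x y \<longleftrightarrow>
     (\<forall>k<N. v k \<in> carrier_vec (n * n) \<and> schmidt_decomp n (v k) (s k) (x k) (y k)) \<and>
     \<rho> = mixture (n * n) (map v [0..<N])"

lemma mixture_upt_index:
  assumes "\<And>k. k < N \<Longrightarrow> v k \<in> carrier_vec d" "i < d" "j < d"
  shows "mixture d (map v [0..<N]) $$ (i, j) = (\<Sum>k<N. v k $ i * cnj (v k $ j))"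
  using assms by (subst mixture_index)
    (auto simp: o_def interv_sum_list_conv_sum_set_nat atLeast0LessThan)

lemma mixture_eqI:
  assumes "set vs \<subseteq> carrier_vec d" "\<rho> \<in> carrier_mat d d"
    "\<And>i j. i < d \<Longrightarrow> j < d \<Longrightarrow> \<rho> $$ (i, j) = mixture d vs $$ (i, j)"
  shows "\<rho> = mixture d vs"
  using mixture_carrier[OF assms(1)] assms(2,3) by (intro eq_matI) auto

lemma schmidt_decomp_norm:
  assumes "schmidt_decomp n v s x y"
  shows "(\<Sum>j<n * n. (cmod (v $ j))\<^sup>2) = (\<Sum>i<n. (s i)\<^sup>2)"
proof -
  have "(\<Sum>j<n * n. (cmod (v $ j))\<^sup>2) = (\<Sum>a<n. \<Sum>b<n. (cmod (\<Sum>i<n. of_real (s i) * x i a * y i b))\<^sup>2)"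
    unfolding sum_product_index using assms by (intro sum.cong refl) (auto simp: schmidt_decomp_def)
  also have "\<dots> = (\<Sum>i<n. (s i)\<^sup>2)"
    using assms by (subst double_orthonormal_norm) (auto simp: schmidt_decomp_def)
  finally show ?thesis .
qed

text \<open>The trace is the total squared norm. This bounds every singular value by one in the
  compactness argument and normalizes the state measured in the realization.\<close>

lemma schmidt_ensemble_trace:
  assumes e: "schmidt_ensemble n N \<rho> v s x y" and tr: "mat_trace \<rho> = 1"
  shows "(\<Sum>k<N. \<Sum>i<n. (s k i)\<^sup>2) = 1"
proof -
  have v: "\<And>k. k < N \<Longrightarrow> v k \<in> carrier_vec (n * n)"
    and d: "\<And>k. k < N \<Longrightarrow> schmidt_decomp n (v k) (s k) (x k) (y k)"
    and \<rho>: "\<rho> = mixture (n * n) (map v [0..<N])"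
    using e by (auto simp: schmidt_ensemble_def)
  have "\<rho> \<in> carrier_mat (n * n) (n * n)" unfolding \<rho> using v by (intro mixture_carrier) auto
  then have "mat_trace \<rho> = (\<Sum>j<n * n. \<rho> $$ (j, j))" by (auto simp: mat_trace_def)
  also have "\<dots> = (\<Sum>j<n * n. \<Sum>k<N. of_real ((cmod (v k $ j))\<^sup>2))"
    unfolding \<rho> complex_norm_square using v by (intro sum.cong refl) (simp add: mixture_upt_index)
  also have "\<dots> = (\<Sum>k<N. \<Sum>j<n * n. of_real ((cmod (v k $ j))\<^sup>2))" by (rule sum.swap)
  also have "\<dots> = of_real (\<Sum>k<N. \<Sum>j<n * n. (cmod (v k $ j))\<^sup>2)" by simp
  also have "(\<Sum>k<N. \<Sum>j<n * n. (cmod (v k $ j))\<^sup>2) = (\<Sum>k<N. \<Sum>i<n. (s k i)\<^sup>2)"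
    using schmidt_decomp_norm[OF d] by simp
  finally show ?thesis using tr by (metis of_real_eq_1_iff)
qed

lemma schmidt_decomp_scale:
  assumes "schmidt_decomp n v s x y" "v \<in> carrier_vec (n * n)" "0 \<le> c"
  shows "schmidt_decomp n (of_real c \<cdot>\<^sub>v v) (\<lambda>i. c * s i) x y"
proof -
  have "(of_real c \<cdot>\<^sub>v v) $ (a * n + b) = (\<Sum>i<n. of_real (c * s i) * x i a * y i b)" if "a < n" "b < n" for a b
    using assms product_index_less[OF that] that by (simp add: schmidt_decomp_def sum_distrib_left mult.assoc)
  then show ?thesis using assms by (simp add: schmidt_decomp_def mult_left_mono)
qed

text \<open>The coordinates for the conic Caratheodory theorem are the real and imaginary parts of
  the entries of the projectors and the \<open>n\<close> Schmidt tails, so \<open>N\<close> is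
  \<open>2 * n ^ 4 + n\<close>, whatever the length of \<open>us\<close>. The weights found are
  absorbed into the vectors through their square roots.\<close>

lemma schmidt_ensemble_bounded_size:
  assumes us: "set us \<subseteq> carrier_vec (n * n)" "us \<noteq> []"
    and N: "N = card (({..<n * n} \<times> {..<n * n} \<times> (UNIV :: bool set)) <+> {..<n})"
  shows "\<exists>v s x y. schmidt_ensemble n N (mixture (n * n) us) v s x y \<and>
    (\<forall>l<n. (\<Sum>k<N. \<Sum>i\<in>{l..<n}. (s k i)\<^sup>2) \<le> (\<Sum>u\<leftarrow>us. schmidt_tail n n l u))"
proof -
  have usc: "us ! m \<in> carrier_vec (n * n)" if "m < length us" for m
    using us(1) that by (meson nth_mem subset_iff)
  have "\<exists>s x y. schmidt_decomp n (us ! m) s x y" if "m < length us" for m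
    using schmidt_decomposition(3)[OF usc[OF that]] by blast
  then obtain s0 x0 y0 where d0: "\<And>m. m < length us \<Longrightarrow> schmidt_decomp n (us ! m) (s0 m) (x0 m) (y0 m)"
    by metis
  define J where "J = ({..<n * n} \<times> {..<n * n} \<times> (UNIV :: bool set)) <+> {..<n}"
  define entry where "entry m i j = us ! m $ i * cnj (us ! m $ j)" for m i j
  define f where "f m z = (case z of
      Inl (i, j, re) \<Rightarrow> if re then Re (entry m i j) else Im (entry m i j)
    | Inr l \<Rightarrow> \<Sum>i\<in>{l..<n}. (s0 m i)\<^sup>2)" for m :: nat and z :: "nat \<times> nat \<times> bool + nat"
  have "finite J" by (simp add: J_def)
  moreover have "{..<length us} \<noteq> {}" using us(2) by (simp add: lessThan_empty_iff)
  ultimately obtain \<kappa> c where "\<forall>k<N. \<kappa> k \<in> {..<length us} \<and> 0 \<le> c k \<and>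
      (\<forall>z\<in>J. (\<Sum>k<N. c k * f (\<kappa> k) z) = (\<Sum>m<length us. f m z))"
    using conic_caratheodory_indexed[of J "{..<length us}" f] unfolding N J_def[symmetric] by auto
  \<comment> \<open>The equality of the sums stands below the quantifier over \<open>k < N\<close>
    and is therefore available only for positive \<open>N\<close>; any element of \<open>J\<close>
    provides this.\<close>
  then have \<kappa>: "\<And>k. k < N \<Longrightarrow> \<kappa> k < length us" "\<And>k. k < N \<Longrightarrow> 0 \<le> c k"
    and sum: "\<And>z. 0 < N \<Longrightarrow> z \<in> J \<Longrightarrow> (\<Sum>k<N. c k * f (\<kappa> k) z) = (\<Sum>m<length us. f m z)"
    by blast+
  define v where "v k = of_real (sqrt (c k)) \<cdot>\<^sub>v us ! \<kappa> k" for k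
  define s where "s k i = sqrt (c k) * s0 (\<kappa> k) i" for k i
  have vc: "v k \<in> carrier_vec (n * n)" if "k < N" for k using usc \<kappa>(1)[OF that] by (simp add: v_def)
  have dec: "schmidt_decomp n (v k) (s k) (x0 (\<kappa> k)) (y0 (\<kappa> k))" if "k < N" for k
    unfolding v_def s_def[abs_def] using d0 usc \<kappa> that by (intro schmidt_decomp_scale) auto
  have Npos: "0 < N" if "z \<in> J" for z
    using that \<open>finite J\<close> unfolding N J_def[symmetric] by (auto simp: card_gt_0_iff)
  have "mixture (n * n) us = mixture (n * n) (map v [0..<N])"
  proof (rule mixture_eqI)
    fix i j assume ij: "i < n * n" "j < n * n"
    have in_J: "Inl (i, j, re) \<in> J" for re using ij by (auto simp: J_def)
    have "(\<Sum>k<N. c k * Re (entry (\<kappa> k) i j)) = (\<Sum>m<length us. Re (entry m i j))"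
      using sum[OF Npos[OF in_J] in_J, of True] by (simp add: f_def)
    moreover have "(\<Sum>k<N. c k * Im (entry (\<kappa> k) i j)) = (\<Sum>m<length us. Im (entry m i j))"
      using sum[OF Npos[OF in_J] in_J, of False] by (simp add: f_def)
    ultimately have "(\<Sum>k<N. of_real (c k) * entry (\<kappa> k) i j) = (\<Sum>m<length us. entry m i j)"
      by (intro complex_eqI) simp_all
    moreover have "v k $ i * cnj (v k $ j) = of_real (c k) * entry (\<kappa> k) i j" if "k < N" for k
    proof -
      have "complex_of_real (sqrt (c k)) * complex_of_real (sqrt (c k)) = of_real (c k)"
        using \<kappa>(2)[OF that] by (simp flip: of_real_mult)
      then show ?thesis using usc[OF \<kappa>(1)[OF that]] ij by (simp add: v_def entry_def mult_ac)
    qed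
    moreover have "mixture (n * n) us $$ (i, j) = (\<Sum>m<length us. entry m i j)"
      using us(1) ij by (simp add: mixture_index sum_list_sum_nth atLeast0LessThan entry_def)
    ultimately show "mixture (n * n) us $$ (i, j) = mixture (n * n) (map v [0..<N]) $$ (i, j)"
      using vc ij by (simp add: mixture_upt_index)
  qed (use us vc in auto)
  then have "schmidt_ensemble n N (mixture (n * n) us) v s (\<lambda>k. x0 (\<kappa> k)) (\<lambda>k. y0 (\<kappa> k))"
    using vc dec by (simp add: schmidt_ensemble_def)
  moreover have "(\<Sum>k<N. \<Sum>i\<in>{l..<n}. (s k i)\<^sup>2) \<le> (\<Sum>u\<leftarrow>us. schmidt_tail n n l u)" if "l < n" for l
  proof -
    have in_J: "Inr l \<in> J" using that by (auto simp: J_def)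
    have "(\<Sum>k<N. \<Sum>i\<in>{l..<n}. (s k i)\<^sup>2) = (\<Sum>k<N. c k * f (\<kappa> k) (Inr l))"
      using \<kappa>(2) by (simp add: s_def f_def power_mult_distrib sum_distrib_left)
    also have "\<dots> = (\<Sum>m<length us. \<Sum>i\<in>{l..<n}. (s0 m i)\<^sup>2)"
      unfolding sum[OF Npos[OF in_J] in_J] by (simp add: f_def)
    also have "\<dots> \<le> (\<Sum>m<length us. schmidt_tail n n l (us ! m))"
      using d0 that by (intro sum_mono schmidt_tail_lower) auto
    finally show ?thesis by (simp add: sum_list_sum_nth atLeast0LessThan)
  qed
  ultimately show ?thesis by blast
qed

text \<open>With \<open>N\<close> fixed, the entries of the bases and the singular values are
  finitely many numbers of modulus at most one, so a subsequence converges. Orthonormality, the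
  order of the singular values, the equation for \<open>\<rho>\<close> and the bounds are closed
  conditions and pass to the limit.\<close>

lemma schmidt_ensemble_limit:
  assumes e: "\<And>m :: nat. schmidt_ensemble n N \<rho> (v m) (s m) (x m) (y m)"
    and tr: "mat_trace \<rho> = 1"
    and c: "c \<longlonglongrightarrow> p"
    and bound: "\<And>m l. l < n \<Longrightarrow> c m * (\<Sum>k<N. \<Sum>i\<in>{l..<n}. (s m k i)\<^sup>2) \<le> M l"
  shows "\<exists>v s x y. schmidt_ensemble n N \<rho> v s x y \<and>
    (\<forall>l<n. p * (\<Sum>k<N. \<Sum>i\<in>{l..<n}. (s k i)\<^sup>2) \<le> M l)"
proof -
  have dec: "schmidt_decomp n (v m k) (s m k) (x m k) (y m k)" and vc: "v m k \<in> carrier_vec (n * n)" if "k < N" for m k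
    using e[of m] that by (auto simp: schmidt_ensemble_def)
  have \<rho>v: "\<rho> = mixture (n * n) (map (v m) [0..<N])" for m using e[of m] by (simp add: schmidt_ensemble_def)
  have \<rho>c: "\<rho> \<in> carrier_mat (n * n) (n * n)" unfolding \<rho>v[of 0] using vc by (intro mixture_carrier) auto
  \<comment> \<open>All data are packed into one family with a tag \<open>t\<close> for
    \<open>x\<close>, \<open>y\<close> and \<open>s\<close>. For \<open>s\<close> the last index is
    a dummy, and below it is read off at \<open>a = i\<close>.\<close>
  define f where "f m z = (case z of (t, k, i, a) \<Rightarrow>
      if t = 0 then x m k i a else if t = 1 then y m k i a else of_real (s m k i))"
    for m and z :: "nat \<times> nat \<times> nat \<times> nat"
  have entry_le: "cmod (q i a) \<le> 1" if "orthonormal n n q" "i < n" "a < n" for q i a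
  proof -
    have "(cmod (q i a))\<^sup>2 \<le> (\<Sum>a<n. (cmod (q i a))\<^sup>2)" by (rule member_le_sum) (use that in auto)
    then show ?thesis using orthonormal_norm[OF that(1,2)] by (simp add: abs_square_le_1)
  qed
  have s_le: "\<bar>s m k i\<bar> \<le> 1" if "k < N" "i < n" for m k i
  proof -
    have "(s m k i)\<^sup>2 \<le> (\<Sum>i<n. (s m k i)\<^sup>2)" by (rule member_le_sum) (use that in auto)
    also have "\<dots> \<le> (\<Sum>k<N. \<Sum>i<n. (s m k i)\<^sup>2)"
      by (rule member_le_sum[of k "{..<N}" "\<lambda>k. \<Sum>i<n. (s m k i)\<^sup>2"]) (use that in \<open>auto intro: sum_nonneg\<close>)
    also have "\<dots> = 1" by (rule schmidt_ensemble_trace[OF e tr])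
    finally show ?thesis by (simp add: abs_square_le_1)
  qed
  define I where "I = {..<3::nat} \<times> {..<N} \<times> {..<n} \<times> {..<n}"
  have "cmod (f m z) \<le> 1" if "z \<in> I" for m z
  proof -
    obtain t k i a where z: "z = (t, k, i, a)" "k < N" "i < n" "a < n" using \<open>z \<in> I\<close> by (auto simp: I_def)
    then show ?thesis
      using entry_le[of "x m k" i a] entry_le[of "y m k" i a] s_le[of k i m] dec[of k m]
      by (auto simp: f_def schmidt_decomp_def)
  qed
  then obtain r :: "nat \<Rightarrow> nat" where r: "strict_mono r" "\<And>z. z \<in> I \<Longrightarrow> convergent (\<lambda>m. f (r m) z)"
    using bounded_family_convergent_subseq[of I f 1] by (auto simp: I_def)
  then obtain L where L: "\<And>z. z \<in> I \<Longrightarrow> (\<lambda>m. f (r m) z) \<longlonglongrightarrow> L z"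
    unfolding convergent_def by metis
  define x' where "x' k i a = L (0, k, i, a)" for k i a
  define y' where "y' k i a = L (1, k, i, a)" for k i a
  define s' where "s' k i = Re (L (2, k, i, i))" for k i
  have lx: "(\<lambda>m. x (r m) k i a) \<longlonglongrightarrow> x' k i a" if "k < N" "i < n" "a < n" for k i a
    using L[of "(0, k, i, a)"] that by (simp add: I_def f_def x'_def)
  have ly: "(\<lambda>m. y (r m) k i a) \<longlonglongrightarrow> y' k i a" if "k < N" "i < n" "a < n" for k i a
    using L[of "(1, k, i, a)"] that by (simp add: I_def f_def y'_def)
  have ls: "(\<lambda>m. s (r m) k i) \<longlonglongrightarrow> s' k i" if "k < N" "i < n" for k i
    using tendsto_Re[OF L[of "(2, k, i, i)"]] that by (simp add: I_def f_def s'_def)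
  have orth: "orthonormal n n (q' k)"
    if q: "\<And>m. orthonormal n n (q m k)" and lq: "\<And>i a. i < n \<Longrightarrow> a < n \<Longrightarrow> (\<lambda>m. q (r m) k i a) \<longlonglongrightarrow> q' k i a"
    for q :: "nat \<Rightarrow> nat \<Rightarrow> nat \<Rightarrow> nat \<Rightarrow> complex" and q' k
    unfolding orthonormal_def
  proof (intro allI impI)
    fix i j assume ij: "i < n" "j < n"
    have "(\<lambda>m. cinner n (q (r m) k i) (q (r m) k j)) \<longlonglongrightarrow> cinner n (q' k i) (q' k j)"
      unfolding cinner_def using lq ij by (intro tendsto_sum tendsto_mult tendsto_cnj) auto
    moreover have "cinner n (q (r m) k i) (q (r m) k j) = (if i = j then 1 else 0)" for m
      using q[of "r m"] ij by (simp add: orthonormal_def)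
    ultimately show "cinner n (q' k i) (q' k j) = (if i = j then 1 else 0)"
      by (simp add: LIMSEQ_const_iff)
  qed
  have ox: "orthonormal n n (x' k)" if "k < N" for k
    using orth[of x k x'] dec[OF that] lx[OF that] by (simp add: schmidt_decomp_def)
  have oy: "orthonormal n n (y' k)" if "k < N" for k
    using orth[of y k y'] dec[OF that] ly[OF that] by (simp add: schmidt_decomp_def)
  have s0: "0 \<le> s' k i" if "k < N" "i < n" for k i
    using ls[OF that] dec[OF that(1)] that(2) by (intro LIMSEQ_le_const) (auto simp: schmidt_decomp_def)
  have sdec: "s' k j \<le> s' k i" if "k < N" "j < n" "i \<le> j" for k i j
    using ls[of k j] ls[of k i] dec[OF that(1)] that by (intro LIMSEQ_le[of _ _ "\<lambda>m. s (r m) k i"]) (auto simp: schmidt_decomp_def)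
  \<comment> \<open>The limit vectors are assembled from the limits of the bases and singular
    values; \<open>div\<close> and \<open>mod\<close> recover the indices of Alice and Bob.\<close>
  define v' where "v' k = vec (n * n) (\<lambda>j. \<Sum>i<n. of_real (s' k i) * x' k i (j div n) * y' k i (j mod n))" for k
  have v'c: "v' k \<in> carrier_vec (n * n)" for k by (simp add: v'_def)
  have dec': "schmidt_decomp n (v' k) (s' k) (x' k) (y' k)" if "k < N" for k
    unfolding schmidt_decomp_def
    using ox oy s0 sdec that product_index_less by (auto simp: v'_def)
  have lv: "(\<lambda>m. v (r m) k $ j) \<longlonglongrightarrow> v' k $ j" if k: "k < N" and j: "j < n * n" for k j
  proof -
    have "0 < n" using j by (cases n) auto
    then have jn: "j div n < n" "j mod n < n" using j by (auto simp: less_mult_imp_div_less)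
    have "v (r m) k $ j = (\<Sum>i<n. of_real (s (r m) k i) * x (r m) k i (j div n) * y (r m) k i (j mod n))" for m
    proof -
      have "v (r m) k $ (j div n * n + j mod n)
        = (\<Sum>i<n. of_real (s (r m) k i) * x (r m) k i (j div n) * y (r m) k i (j mod n))"
        using dec[OF k, of "r m"] jn unfolding schmidt_decomp_def by blast
      then show ?thesis by simp
    qed
    moreover have "v' k $ j = (\<Sum>i<n. of_real (s' k i) * x' k i (j div n) * y' k i (j mod n))"
      using j by (simp add: v'_def)
    ultimately show ?thesis
      using lx[OF k _ jn(1)] ly[OF k _ jn(2)] ls[OF k]
      by (simp only:) (intro tendsto_sum tendsto_mult tendsto_of_real, auto)
  qed
  have "\<rho> = mixture (n * n) (map v' [0..<N])"
  proof (rule mixture_eqI[OF _ \<rho>c])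
    show "set (map v' [0..<N]) \<subseteq> carrier_vec (n * n)" using v'c by auto
    fix i j assume ij: "i < n * n" "j < n * n"
    have "(\<lambda>m. \<Sum>k<N. v (r m) k $ i * cnj (v (r m) k $ j)) \<longlonglongrightarrow> (\<Sum>k<N. v' k $ i * cnj (v' k $ j))"
      using lv ij by (intro tendsto_sum tendsto_mult tendsto_cnj) auto
    moreover have "(\<Sum>k<N. v (r m) k $ i * cnj (v (r m) k $ j)) = \<rho> $$ (i, j)" for m
      unfolding \<rho>v[of "r m"] using vc ij by (simp add: mixture_upt_index)
    ultimately have "\<rho> $$ (i, j) = (\<Sum>k<N. v' k $ i * cnj (v' k $ j))" by (simp add: LIMSEQ_const_iff)
    then show "\<rho> $$ (i, j) = mixture (n * n) (map v' [0..<N]) $$ (i, j)"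
      using v'c ij by (simp add: mixture_upt_index)
  qed
  then have "schmidt_ensemble n N \<rho> v' s' x' y'" using v'c dec' by (simp add: schmidt_ensemble_def)
  moreover have "p * (\<Sum>k<N. \<Sum>i\<in>{l..<n}. (s' k i)\<^sup>2) \<le> M l" if "l < n" for l
  proof (rule LIMSEQ_le_const2)
    have "(\<lambda>m. c (r m)) \<longlonglongrightarrow> p" using LIMSEQ_subseq_LIMSEQ[OF c r(1)] by (simp add: o_def)
    then show "(\<lambda>m. c (r m) * (\<Sum>k<N. \<Sum>i\<in>{l..<n}. (s (r m) k i)\<^sup>2))
        \<longlonglongrightarrow> p * (\<Sum>k<N. \<Sum>i\<in>{l..<n}. (s' k i)\<^sup>2)"
      using ls by (intro tendsto_mult tendsto_sum tendsto_power) auto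
    show "\<exists>m0. \<forall>m\<ge>m0. c (r m) * (\<Sum>k<N. \<Sum>i\<in>{l..<n}. (s (r m) k i)\<^sup>2) \<le> M l"
      using bound[OF that] by blast
  qed
  ultimately show ?thesis by blast
qed

section \<open>Realization by a diagonal measurement\<close>

text \<open>The reduced state is diagonal, so its characteristic polynomial displays the
  eigenvalues, and the decreasing order of \<open>lam\<close> is the one used by
  \<open>schmidt_coeffs\<close>.\<close>

lemma schmidt_coeffs_diagonal:
  fixes lam :: "nat \<Rightarrow> real"
  assumes nonneg: "\<And>i. i < n \<Longrightarrow> 0 \<le> lam i" and dec: "\<And>i j. j < n \<Longrightarrow> i \<le> j \<Longrightarrow> lam j \<le> lam i"
  shows "schmidt_coeffs n (vec (n * n) (\<lambda>j. if j div n = j mod n then of_real (sqrt (lam (j div n))) else 0))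
    = map lam [0..<n]" (is "schmidt_coeffs n ?\<phi> = _")
proof -
  have \<phi>: "?\<phi> $ (a * n + b) = (if a = b then of_real (sqrt (lam a)) else 0)" if "a < n" "b < n" for a b
    using that product_index_less[OF that] by simp
  let ?G = "ptrace_A n n (projector ?\<phi>)"
  have G: "?G $$ (b, b') = (if b = b' then of_real (lam b) else 0)" if "b < n" "b' < n" for b b'
  proof -
    have "?G $$ (b, b') = (\<Sum>a<n. ?\<phi> $ (a * n + b) * cnj (?\<phi> $ (a * n + b')))"
      using that by (intro ptrace_A_index) auto
    also have "\<dots> = (\<Sum>a<n. if a = b then if b = b' then of_real (sqrt (lam b)) * of_real (sqrt (lam b)) else 0 else 0)"
      using that by (intro sum.cong) (auto simp: \<phi> simp del: index_vec)
    also have "\<dots> = (if b = b' then of_real (lam b) else 0)"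
      using that nonneg[OF that(1)] by (cases "b = b'") (simp_all flip: of_real_mult)
    finally show ?thesis .
  qed
  note Gc = ptrace_A_carrier[of n n "projector ?\<phi>"]
  have "upper_triangular ?G" using G Gc by (auto simp: upper_triangular_def)
  then have "char_poly ?G = (\<Prod>a\<leftarrow>diag_mat ?G. [:- a, 1:])" by (rule char_poly_upper_triangular[OF Gc])
  moreover have "diag_mat ?G = map (\<lambda>i. complex_of_real (lam i)) [0..<n]"
    using G Gc by (auto simp: diag_mat_def)
  ultimately have "proots (char_poly ?G) = mset (map (\<lambda>i. complex_of_real (lam i)) [0..<n])"
    by (simp only: proots_linear_factors)
  then have "image_mset Re (proots (char_poly ?G)) = mset (rev (map lam [0..<n]))"
    by (simp add: multiset.map_comp o_def)
  moreover have "sorted (rev (map lam [0..<n]))"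
    using dec by (auto simp: sorted_rev_iff_nth_mono)
  ultimately show ?thesis
    unfolding schmidt_coeffs_def by (simp add: sorted_list_of_multiset_mset sorted_sort_id del: mset_rev mset_map)
qed

lemma weak_supermaj_pure_in_S_set:
  assumes "pure_state (n * n) \<phi>" "weak_supermaj p (schmidt_coeffs n \<phi>) \<mu>"
  shows "projector \<phi> \<in> S_set n \<mu> p"
proof -
  have c: "projector \<phi> \<in> carrier_mat (n * n) (n * n)" using assms(1) by (simp add: pure_state_def)
  then have "projector \<phi> = sum_mats (n * n) (n * n) (map (\<lambda>(q, M). complex_of_real q \<cdot>\<^sub>m M) [(1, projector \<phi>)])"
    by (intro eq_matI) (auto simp: sum_mats_def)
  then show ?thesis
    unfolding S_set_def mat_convex_hull_def using assms
    by (intro CollectI exI[of _ "[(1, projector \<phi>)]"]) auto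
qed

text \<open>With \<open>\<lambda> i = (\<Sum>k. (s k i)\<^sup>2)\<close>, Alice's diagonal Kraus operators \<open>diag (s k i / sqrt (\<lambda> i))\<close>
  turn the diagonal state with Schmidt coefficients \<open>\<lambda>\<close> into the given ensemble, up to local unitaries.\<close>

lemma schmidt_ensemble_in_S_plus:
  assumes e: "schmidt_ensemble n N \<rho> v s x y" and tr: "mat_trace \<rho> = 1"
    and len: "length \<mu> = n"
    and bound: "\<And>l. l < n \<Longrightarrow> p * (\<Sum>k<N. \<Sum>i\<in>{l..<n}. (s k i)\<^sup>2) \<le> sum_list (drop l \<mu>)"
  shows "\<rho> \<in> S_plus n \<mu> p"
proof -
  have dec: "\<And>k. k < N \<Longrightarrow> schmidt_decomp n (v k) (s k) (x k) (y k)"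
    and vc: "\<And>k. k < N \<Longrightarrow> v k \<in> carrier_vec (n * n)"
    and \<rho>: "\<rho> = mixture (n * n) (map v [0..<N])"
    using e by (auto simp: schmidt_ensemble_def)
  have sum1: "(\<Sum>k<N. \<Sum>i<n. (s k i)\<^sup>2) = 1" by (rule schmidt_ensemble_trace[OF e tr])
  then have N: "0 < N" by (cases N) auto
  define lam where "lam i = (\<Sum>k<N. (s k i)\<^sup>2)" for i
  have lam_nonneg: "0 \<le> lam i" for i unfolding lam_def by (intro sum_nonneg) auto
  \<comment> \<open>All branches list their singular values in decreasing order, so the squares add
    up to a decreasing list without any rearrangement.\<close>
  have lam_dec: "lam j \<le> lam i" if "j < n" "i \<le> j" for i j
    unfolding lam_def using dec that by (intro sum_mono power_mono) (auto simp: schmidt_decomp_def)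
  have lam0: "s k i = 0" if "lam i = 0" "k < N" for k i
  proof -
    have "(s k i)\<^sup>2 = 0" using that unfolding lam_def by (subst (asm) sum_nonneg_eq_0_iff) auto
    then show ?thesis by simp
  qed
  define \<phi> where "\<phi> = vec (n * n) (\<lambda>j. if j div n = j mod n then complex_of_real (sqrt (lam (j div n))) else 0)"
  have \<phi>c: "\<phi> \<in> carrier_vec (n * n)" by (simp add: \<phi>_def)
  have \<phi>: "\<phi> $ (a * n + b) = (if a = b then of_real (sqrt (lam a)) else 0)" if "a < n" "b < n" for a b
    using that product_index_less[OF that] by (simp add: \<phi>_def)
  have coeffs: "schmidt_coeffs n \<phi> = map lam [0..<n]"
    unfolding \<phi>_def by (rule schmidt_coeffs_diagonal) (use lam_nonneg lam_dec in auto)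
  have "\<phi> \<bullet>c \<phi> = (\<Sum>j<n * n. \<phi> $ j * cnj (\<phi> $ j))"
    using \<phi>c by (simp add: scalar_prod_def atLeast0LessThan)
  also have "\<dots> = (\<Sum>a<n. \<Sum>b<n. \<phi> $ (a * n + b) * cnj (\<phi> $ (a * n + b)))" by (rule sum_product_index)
  also have "\<dots> = (\<Sum>a<n. \<Sum>b<n. if b = a then of_real (lam a) else 0)"
    using lam_nonneg by (intro sum.cong refl) (auto simp: \<phi> simp flip: of_real_mult)
  also have "\<dots> = of_real (\<Sum>a<n. lam a)" by simp
  also have "(\<Sum>a<n. lam a) = 1" unfolding lam_def by (subst sum.swap) (rule sum1)
  finally have pure: "pure_state (n * n) \<phi>" using \<phi>c by (simp add: pure_state_def)
  have "weak_supermaj p (schmidt_coeffs n \<phi>) \<mu>"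
    unfolding weak_supermaj_def coeffs
  proof (intro conjI allI impI)
    fix l assume "l < length \<mu>"
    then have l: "l < n" using len by simp
    have "sum_list (drop l (map lam [0..<n])) = (\<Sum>i\<in>{l..<n}. lam i)"
      by (simp add: drop_map interv_sum_list_conv_sum_set_nat)
    also have "\<dots> = (\<Sum>k<N. \<Sum>i\<in>{l..<n}. (s k i)\<^sup>2)" unfolding lam_def by (rule sum.swap)
    finally show "p * sum_list (drop l (map lam [0..<n])) \<le> sum_list (drop l \<mu>)" using bound[OF l] by simp
  qed (use len in simp)
  then have inS: "projector \<phi> \<in> S_set n \<mu> p" by (rule weak_supermaj_pure_in_S_set[OF pure])
  \<comment> \<open>Where \<open>lam i = 0\<close> the quotient is meaningless. Assigning such an
    index entirely to the outcome \<open>0\<close>, which exists since \<open>N\<close> is positive,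
    keeps the completeness relation, and \<open>\<phi>\<close> has no amplitude there.\<close>
  define w where "w k i = (if lam i = 0 then if k = 0 then 1 else 0 else s k i / sqrt (lam i))" for k :: nat and i
  define A where "A k = mat n n (\<lambda>(i, j). if i = j then complex_of_real (w k i) else 0)" for k
  have AA: "mat_adjoint (A k) * A k \<in> carrier_mat n n" for k
    by (rule mult_carrier_mat[of _ _ n]) (simp_all add: A_def carrier_matI)
  define U where "U k = mat n n (\<lambda>(a, i). x k i a)" for k
  define V where "V k = mat n n (\<lambda>(a, i). y k i a)" for k
  have carr: "A k \<in> carrier_mat n n" "U k \<in> carrier_mat n n" "V k \<in> carrier_mat n n" for k
    by (simp_all add: A_def U_def V_def)
  have unit: "unitary_mat n (U k)" "unitary_mat n (V k)" if "k < N" for k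
    unfolding U_def V_def using dec[OF that] by (auto simp: schmidt_decomp_def intro: unitary_mat_of_orthonormal)
  have mult_diag: "(B * A k) $$ (a, i) = B $$ (a, i) * of_real (w k i)"
    if "B \<in> carrier_mat n n" "a < n" "i < n" for B k a i
  proof -
    have "(B * A k) $$ (a, i) = (\<Sum>j<n. B $$ (a, j) * A k $$ (j, i))"
      using that carr by (simp add: scalar_prod_def atLeast0LessThan A_def)
    also have "\<dots> = (\<Sum>j<n. if j = i then B $$ (a, i) * of_real (w k i) else 0)"
      using that by (intro sum.cong) (auto simp: A_def)
    finally show ?thesis using that by simp
  qed
  have comm: "A k * A k' = A k' * A k" for k k'
  proof (rule eq_matI)
    fix i j assume "i < dim_row (A k' * A k)" "j < dim_col (A k' * A k)"
    then have ij: "i < n" "j < n" using carr(1)[of k] carr(1)[of k'] by auto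
    show "(A k * A k') $$ (i, j) = (A k' * A k) $$ (i, j)"
      unfolding mult_diag[OF carr(1) ij] using ij by (simp add: A_def mult.commute)
  qed (use carr(1)[of k] carr(1)[of k'] in auto)
  have w1: "(\<Sum>k<N. (w k i)\<^sup>2) = 1" for i
  proof (cases "lam i = 0")
    case True
    then have "(\<Sum>k<N. (w k i)\<^sup>2) = (\<Sum>k<N. if k = 0 then 1 else 0)"
      by (intro sum.cong) (auto simp: w_def)
    then show ?thesis using N by simp
  next
    case False
    then have "(\<Sum>k<N. (w k i)\<^sup>2) = (\<Sum>k<N. (s k i)\<^sup>2 / lam i)"
      using lam_nonneg[of i] by (intro sum.cong) (auto simp: w_def power_divide)
    also have "\<dots> = lam i / lam i" by (subst (2) lam_def) (rule sum_divide_distrib[symmetric])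
    finally show ?thesis using False by simp
  qed
  have complete: "sum_mats n n (map (\<lambda>k. mat_adjoint (A k) * A k) [0..<N]) = 1\<^sub>m n" (is "?S = _")
  proof (rule eq_matI)
    have Sc: "?S \<in> carrier_mat n n" using AA by (intro sum_mats_carrier) auto
    then show "dim_row ?S = dim_row (1\<^sub>m n)" "dim_col ?S = dim_col (1\<^sub>m n)" by auto
    fix i j assume "i < dim_row (1\<^sub>m n)" "j < dim_col (1\<^sub>m n)"
    then have ij: "i < n" "j < n" by auto
    have "?S $$ (i, j) = (\<Sum>M\<leftarrow>map (\<lambda>k. mat_adjoint (A k) * A k) [0..<N]. M $$ (i, j))"
      using AA ij by (intro sum_mats_index) auto
    also have "\<dots> = (\<Sum>k<N. (mat_adjoint (A k) * A k) $$ (i, j))"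
      by (simp add: o_def interv_sum_list_conv_sum_set_nat atLeast0LessThan del: index_mult_mat(1))
    also have "\<dots> = (\<Sum>k<N. if i = j then of_real ((w k i)\<^sup>2) else 0)"
    proof (intro sum.cong refl)
      fix k
      have "(mat_adjoint (A k) * A k) $$ (i, j) = mat_adjoint (A k) $$ (i, j) * of_real (w k j)"
        using carr ij by (intro mult_diag) auto
      then show "(mat_adjoint (A k) * A k) $$ (i, j) = (if i = j then of_real ((w k i)\<^sup>2) else 0)"
        using ij by (simp add: A_def power2_eq_square)
    qed
    also have "\<dots> = (if i = j then of_real (\<Sum>k<N. (w k i)\<^sup>2) else 0)" by simp
    also have "\<dots> = 1\<^sub>m n $$ (i, j)" using ij by (simp only: w1) simp
    finally show "?S $$ (i, j) = 1\<^sub>m n $$ (i, j)" .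
  qed
  define L where "L = apply_kraus (n * n) (map (\<lambda>k. kron (U k * A k) (V k)) [0..<N])"
  have "locc1A n L"
    unfolding locc1A_def L_def using carr unit comm complete
    by (intro exI[of _ N] exI[of _ A] exI[of _ U] exI[of _ V]) auto
  moreover have "L (projector \<phi>) = \<rho>"
  proof -
    have branch: "kron (U k * A k) (V k) *\<^sub>v \<phi> = v k" if k: "k < N" for k
    proof (rule eq_vecI)
      have UA: "U k * A k \<in> carrier_mat n n" using carr by (intro mult_carrier_mat) auto
      show "dim_vec (kron (U k * A k) (V k) *\<^sub>v \<phi>) = dim_vec (v k)"
        using kron_carrier[OF UA carr(3)[of k]] vc[OF k] by auto
      fix j assume "j < dim_vec (v k)"
      then have j: "j < n * n" using vc[OF k] by auto
      then have "0 < n" by (cases n) auto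
      then have jn: "j div n < n" "j mod n < n" using j by (auto simp: less_mult_imp_div_less)
      define a b where "a = j div n" and "b = j mod n"
      have ab: "a < n" "b < n" and jab: "j = a * n + b" using jn by (auto simp: a_def b_def)
      have "(kron (U k * A k) (V k) *\<^sub>v \<phi>) $ (a * n + b)
        = (\<Sum>i<n. \<Sum>i'<n. (U k * A k) $$ (a, i) * V k $$ (b, i') * \<phi> $ (i * n + i'))"
        by (rule kron_mult_vec[OF UA carr(3) \<phi>c ab])
      also have "\<dots> = (\<Sum>i<n. \<Sum>i'<n. if i' = i then x k i a * of_real (w k i) * y k i b * of_real (sqrt (lam i)) else 0)"
        using ab carr by (intro sum.cong refl) (auto simp: mult_diag \<phi> U_def V_def simp del: index_mult_mat(1))
      also have "\<dots> = (\<Sum>i<n. of_real (s k i) * x k i a * y k i b)"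
      proof (intro sum.cong refl)
        fix i assume i: "i \<in> {..<n}"
        \<comment> \<open>If \<open>lam i\<close> is zero then so is \<open>s k i\<close>, so the
          default value of \<open>w\<close> does no harm.\<close>
        have "w k i * sqrt (lam i) = s k i" using lam0[OF _ k] by (auto simp: w_def)
        then have ws: "complex_of_real (w k i) * of_real (sqrt (lam i)) = of_real (s k i)"
          by (simp flip: of_real_mult)
        have "x k i a * of_real (w k i) * y k i b * of_real (sqrt (lam i))
          = (of_real (w k i) * of_real (sqrt (lam i))) * x k i a * y k i b"
          by (simp only: mult_ac)
        then have "x k i a * of_real (w k i) * y k i b * of_real (sqrt (lam i)) = of_real (s k i) * x k i a * y k i b"
          unfolding ws .
        then show "(\<Sum>i'<n. if i' = i then x k i a * of_real (w k i) * y k i b * of_real (sqrt (lam i)) else 0)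
          = of_real (s k i) * x k i a * y k i b" using i by simp
      qed
      also have "\<dots> = v k $ (a * n + b)" using dec[OF k] ab by (simp add: schmidt_decomp_def)
      finally show "(kron (U k * A k) (V k) *\<^sub>v \<phi>) $ j = v k $ j" unfolding jab .
    qed
    have "L (projector \<phi>) = mixture (n * n) (concat (map (\<lambda>K. map (\<lambda>v. K *\<^sub>v v) [\<phi>]) (map (\<lambda>k. kron (U k * A k) (V k)) [0..<N])))"
      unfolding L_def mixture_singleton[OF \<phi>c, symmetric]
      using carr \<phi>c by (intro apply_kraus_mixture) (auto intro!: kron_carrier mult_carrier_mat)
    also have "concat (map (\<lambda>K. map (\<lambda>v. K *\<^sub>v v) [\<phi>]) (map (\<lambda>k. kron (U k * A k) (V k)) [0..<N])) = map v [0..<N]"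
      using branch by (simp add: o_def)
    finally show ?thesis using \<rho> by simp
  qed
  ultimately show ?thesis unfolding S_plus_def using pure inS by blast
qed

section \<open>Strictness of the bound\<close>

theorem corollary3:
  fixes n :: nat and \<mu> :: "real list" and \<psi> :: "complex vec"
    and p p1 :: real and \<rho>1 \<rho>2 :: "complex mat"
  assumes "schmidt_vector n \<mu>"
    and "pure_state (n * n) \<psi>" and "schmidt_coeffs n \<psi> = \<mu>"
    and "0 < p" and "p \<le> 1"
    and "density_mat (n * n) \<rho>1" and "density_mat (n * n) \<rho>2"
    and "\<rho>1 \<in> S_plus n \<mu> p"
    and "obtainable n (projector \<psi>) \<rho>1 p1" and "p \<le> p1"
    and "\<rho>2 \<notin> S_plus n \<mu> p"
  shows "max_success_prob n \<rho>1 \<rho>2 < p / p1"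
proof (rule ccontr)
  assume "\<not> ?thesis"
  \<comment> \<open>The supremum might not be attained, so this yields only success probabilities
    arbitrarily close to \<open>p / p1\<close> or above it; the limit of ensembles below closes the
    gap.\<close>
  then have sup: "p / p1 \<le> Sup {r. obtainable n \<rho>1 \<rho>2 r}" by (simp add: max_success_prob_def)
  have p1: "0 < p1" using assms(4,10) by simp
  have \<psi>: "\<psi> \<in> carrier_vec (n * n)" using assms(2) by (simp add: pure_state_def)
  have \<rho>c: "\<rho>1 \<in> carrier_mat (n * n) (n * n)" "\<rho>2 \<in> carrier_mat (n * n) (n * n)" and tr: "mat_trace \<rho>2 = 1"
    using assms(6,7) by (auto simp: density_mat_def)
  have len: "length \<mu> = n" using assms(1) by (simp add: schmidt_vector_def)
  have "obtainable n (mixture (n * n) [\<psi>]) \<rho>1 p1" using assms(9) mixture_singleton[OF \<psi>] by simp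
  from obtainable_tail_monotone[OF this p1 _ \<rho>c(1)] \<psi> obtain ws where
    ws: "set ws \<subseteq> carrier_vec (n * n)" "\<rho>1 = mixture (n * n) ws"
    "\<And>l. p1 * (\<Sum>w\<leftarrow>ws. schmidt_tail n n l w) \<le> schmidt_tail n n l \<psi>" by auto
  define M where "M l = sum_list (drop l \<mu>)" for l
  have tail_\<psi>: "schmidt_tail n n l \<psi> \<le> M l" if "l < n" for l
    using schmidt_tail_schmidt_coeffs[OF \<psi>, of l] that assms(3) by (simp add: M_def)
  define N where "N = card (({..<n * n} \<times> {..<n * n} \<times> (UNIV :: bool set)) <+> {..<n})"
  \<comment> \<open>For \<open>c < p\<close> some success probability \<open>r\<close> exceeds
    \<open>c / p1\<close>. Chaining the two protocols gives the tail bound with the factor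
    \<open>p1 * r\<close>, hence also with \<open>c\<close>, for an ensemble whose size
    \<open>N\<close> does not depend on \<open>c\<close>.\<close>
  have ensemble: "\<exists>v s x y. schmidt_ensemble n N \<rho>2 v s x y \<and>
      (\<forall>l<n. c * (\<Sum>k<N. \<Sum>i\<in>{l..<n}. (s k i)\<^sup>2) \<le> M l)" if c: "0 < c" "c < p" for c
  proof -
    have "c / p1 < p / p1" using c p1 by (simp add: divide_strict_right_mono)
    then have "c / p1 < Sup {r. obtainable n \<rho>1 \<rho>2 r}" using sup by linarith
    moreover have "{r. obtainable n \<rho>1 \<rho>2 r} \<noteq> {}" using obtainable_0[OF \<rho>c(2)] by blast
    ultimately obtain r where r: "obtainable n \<rho>1 \<rho>2 r" "c / p1 < r"
      using less_cSupD[of "{r. obtainable n \<rho>1 \<rho>2 r}" "c / p1"] by auto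
    have r0: "0 < r" using r(2) divide_pos_pos[OF c(1) p1] by linarith
    have cr: "c \<le> p1 * r" using r(2) p1 by (simp add: field_simps)
    obtain us where us: "set us \<subseteq> carrier_vec (n * n)" "\<rho>2 = mixture (n * n) us"
      "\<And>l. r * (\<Sum>u\<leftarrow>us. schmidt_tail n n l u) \<le> (\<Sum>w\<leftarrow>ws. schmidt_tail n n l w)"
      using obtainable_tail_monotone[OF r(1)[unfolded ws(2)] r0 ws(1) \<rho>c(2)] by blast
    have "us \<noteq> []"
    proof
      assume "us = []"
      then have "mat_trace \<rho>2 = 0" using us(2) by (simp add: mixture_def sum_mats_def mat_trace_def)
      then show False using tr by simp
    qed
    from schmidt_ensemble_bounded_size[OF us(1) this N_def] obtain v s x y where
      d: "schmidt_ensemble n N \<rho>2 v s x y"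
      "\<forall>l<n. (\<Sum>k<N. \<Sum>i\<in>{l..<n}. (s k i)\<^sup>2) \<le> (\<Sum>u\<leftarrow>us. schmidt_tail n n l u)"
      unfolding us(2) by blast
    have "c * (\<Sum>k<N. \<Sum>i\<in>{l..<n}. (s k i)\<^sup>2) \<le> M l" if "l < n" for l
    proof -
      have "c * (\<Sum>k<N. \<Sum>i\<in>{l..<n}. (s k i)\<^sup>2) \<le> p1 * r * (\<Sum>k<N. \<Sum>i\<in>{l..<n}. (s k i)\<^sup>2)"
        using cr by (intro mult_right_mono sum_nonneg) auto
      also have "\<dots> \<le> p1 * r * (\<Sum>u\<leftarrow>us. schmidt_tail n n l u)"
        using d(2) that p1 r0 by (intro mult_left_mono) auto
      also have "\<dots> \<le> p1 * (\<Sum>w\<leftarrow>ws. schmidt_tail n n l w)"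
        using us(3)[of l] p1 by (simp add: mult.assoc mult_left_mono)
      also have "\<dots> \<le> M l" using ws(3)[of l] tail_\<psi>[OF that] by linarith
      finally show ?thesis .
    qed
    with d(1) show ?thesis by blast
  qed
  \<comment> \<open>Any sequence strictly between 0 and \<open>p\<close> with limit \<open>p\<close>
    would do; the shift by 2 makes already the first term positive.\<close>
  define c where "c m = p * (1 - 1 / real (m + 2))" for m :: nat
  have cpos: "0 < c m" "c m < p" for m using assms(4) by (auto simp: c_def field_simps add_pos_nonneg)
  have "(\<lambda>m. 1 / real (m + 2)) \<longlonglongrightarrow> 0" using LIMSEQ_ignore_initial_segment[OF lim_1_over_n, of 2] by simp
  then have "(\<lambda>m. p * (1 - 1 / real (m + 2))) \<longlonglongrightarrow> p * (1 - 0)" by (intro tendsto_intros)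
  then have climit: "c \<longlonglongrightarrow> p" by (simp add: c_def[abs_def])
  define Q where "Q m v s x y \<longleftrightarrow> schmidt_ensemble n N \<rho>2 v s x y \<and>
    (\<forall>l<n. c m * (\<Sum>k<N. \<Sum>i\<in>{l..<n}. (s k i)\<^sup>2) \<le> M l)" for m v s x y
  have "\<forall>m. \<exists>v s x y. Q m v s x y" unfolding Q_def by (intro allI ensemble cpos)
  from choice[OF this] obtain v where "\<forall>m. \<exists>s x y. Q m (v m) s x y" by blast
  from choice[OF this] obtain s where "\<forall>m. \<exists>x y. Q m (v m) (s m) x y" by blast
  from choice[OF this] obtain x where "\<forall>m. \<exists>y. Q m (v m) (s m) (x m) y" by blast
  from choice[OF this] obtain y where Q: "\<And>m. Q m (v m) (s m) (x m) (y m)" by blast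
  then have "\<And>m. schmidt_ensemble n N \<rho>2 (v m) (s m) (x m) (y m)"
    "\<And>m l. l < n \<Longrightarrow> c m * (\<Sum>k<N. \<Sum>i\<in>{l..<n}. (s m k i)\<^sup>2) \<le> M l"
    unfolding Q_def by blast+
  from schmidt_ensemble_limit[OF this(1) tr climit this(2)] obtain v s x y where
    e: "schmidt_ensemble n N \<rho>2 v s x y" "\<forall>l<n. p * (\<Sum>k<N. \<Sum>i\<in>{l..<n}. (s k i)\<^sup>2) \<le> M l" by blast
  \<comment> \<open>The limit ensemble satisfies the bounds with \<open>p\<close> itself, so the
    diagonal measurement realizes \<open>\<rho>2\<close>, against the assumption.\<close>
  have "\<rho>2 \<in> S_plus n \<mu> p"
    using e(2) by (intro schmidt_ensemble_in_S_plus[OF e(1) tr len]) (simp add: M_def)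
  then show False using assms(11) by blast
qed

end
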